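(* Let $\mathcal{S}$ be Thompson's semigroup. Then $H^1(\mathfrak{B}(\mathcal{S}),\mathcal{L}(\mathcal{S}))=0$.
   Context: Thompson's semigroup $\mathcal{S}$ is the discrete cancellative semigroup with unit $e$ given by the presentation $\mathcal{S}=\langle X_0,X_1,X_2,\ldots \mid X_jX_i=X_iX_{j+1},\ j>i\rangle$. $l^2(\mathcal{S})$ is the Hilbert space of square-summable complex functions on $\mathcal{S}$ with orthonormal basis $(\delta_s)_{s\in\mathcal{S}}$. For $f,g\in l^2(\mathcal{S})$ put $(f*g)(s)=\sum_{uv=s}f(u)g(v)$ and $L_fg=f*g$. $\mathcal{L}(\mathcal{S})$ is the algebra of all left convolution operators $L_f$ ($f\in l^2(\mathcal{S})$) that are bounded operators on $l^2(\mathcal{S})$. Write $L_s=L_{\delta_s}$. $\mathfrak{B}(\mathcal{S})$ is the Banach algebra generated by $\{L_s:s\in\mathcal{S}\}$ in $B(l^2(\mathcal{S}))$ (norm-closed subalgebra); it is a subalgebra of $\mathcal{L}(\mathcal{S})$, which is thus a Banach $\mathfrak{B}(\mathcal{S})$-bimodule. For a Banach algebra $\mathcal{A}$ and a Banach $\mathcal{A}$-bimodule $X$, a derivation is a linear map $D:\mathcal{A}\to X$ with $D(AB)=AD(B)+D(A)B$ for all $A,B\in\mathcal{A}$; it is inner if there is $T\in X$ with $D(A)=AT-TA$ for all $A\in\mathcal{A}$. $H^1(\mathcal{A},X)$ is the quotient vector space of the space of all continuous derivations from $\mathcal{A}$ into $X$ by the subspace of inner derivations. *)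

theory Defs
  imports "HOL-Analysis.Analysis"
begin

text \<open>
  Thompson's semigroup as a monoid presentation: words over the letters \<open>X\<^sub>0, X\<^sub>1, \<dots>\<close>
  (a letter is its index) modulo the congruence generated by \<open>X\<^sub>j X\<^sub>i = X\<^sub>i X\<^bsub>j+1\<^esub>\<close>, \<open>j > i\<close>.
\<close>

inductive thompson_step :: "nat list \<Rightarrow> nat list \<Rightarrow> bool" where
  "i < j \<Longrightarrow> thompson_step (u @ [j, i] @ v) (u @ [i, Suc j] @ v)"

quotient_type thompson = "nat list" / "equivclp thompson_step"
  by (rule equivpI) (auto intro: reflpI sympI transpI equivclp_sym equivclp_trans)

lemma thompson_step_append:
  assumes "thompson_step x y"
  shows "thompson_step (p @ x @ q) (p @ y @ q)"
  using assms
proof cases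
  case (1 i j u v)
  then show ?thesis
    using thompson_step.intros[of i j "p @ u" "v @ q"] by simp
qed

lemma equivclp_thompson_step_append:
  assumes "equivclp thompson_step x y"
  shows "equivclp thompson_step (p @ x @ q) (p @ y @ q)"
  using assms
proof (induction rule: equivclp_induct)
  case base
  show ?case by simp
next
  case (step y z)
  from step(2) have "equivclp thompson_step (p @ y @ q) (p @ z @ q)"
    by (metis r_into_equivclp thompson_step_append equivclp_sym)
  with step(3) show ?case
    by (rule equivclp_trans)
qed

instantiation thompson :: monoid_mult
begin

lift_definition one_thompson :: thompson is "[]" .

lift_definition times_thompson :: "thompson \<Rightarrow> thompson \<Rightarrow> thompson" is append
  by (metis append_Nil append_Nil2 equivclp_thompson_step_append equivclp_trans)

instance
  by standard (transfer, simp)+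

end

text \<open>
  The Hilbert space \<open>\<ell>\<^sup>2\<close>. The class \<^class>\<open>real_normed_vector\<close> gives access to the library's
  bounded operators and operator norm; complex scalar multiplication is kept separately.
\<close>

typedef 'a ell2 = "{f :: 'a \<Rightarrow> complex. (\<lambda>x. (cmod (f x))\<^sup>2) summable_on UNIV}"
  morphisms coord Abs_ell2
  by (rule exI[of _ "\<lambda>_. 0"]) simp

setup_lifting type_definition_ell2

lift_definition scaleC_ell2 :: "complex \<Rightarrow> 'a ell2 \<Rightarrow> 'a ell2" is "\<lambda>c f x. c * f x"
  by (simp add: norm_mult power_mult_distrib summable_on_cmult_right)

lift_definition delta :: "'a \<Rightarrow> 'a ell2" is "\<lambda>s x. if x = s then 1 else 0"
proof -
  fix s :: 'a
  have "(\<lambda>x. (cmod (if x = s then 1 else 0))\<^sup>2) summable_on {s}"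
    by simp
  then show "(\<lambda>x. (cmod (if x = s then 1 else 0))\<^sup>2) summable_on UNIV"
    by (rule summable_on_cong_neutral[THEN iffD1, rotated -1]) auto
qed

lemma square_summable_add:
  fixes f g :: "'a \<Rightarrow> complex"
  assumes "(\<lambda>x. (cmod (f x))\<^sup>2) summable_on UNIV" "(\<lambda>x. (cmod (g x))\<^sup>2) summable_on UNIV"
  shows "(\<lambda>x. (cmod (f x + g x))\<^sup>2) summable_on UNIV"
proof (rule summable_on_comparison_test)
  show "(\<lambda>x. 2 * (cmod (f x))\<^sup>2 + 2 * (cmod (g x))\<^sup>2) summable_on UNIV"
    using assms by (intro summable_on_add summable_on_cmult_right)
next
  fix x
  have "(cmod (f x + g x))\<^sup>2 \<le> (cmod (f x) + cmod (g x))\<^sup>2"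
    by (intro power_mono norm_triangle_ineq) simp
  also have "\<dots> \<le> 2 * (cmod (f x))\<^sup>2 + 2 * (cmod (g x))\<^sup>2"
    using zero_le_power2[of "cmod (f x) - cmod (g x)"] unfolding power2_diff power2_sum by linarith
  finally show "(cmod (f x + g x))\<^sup>2 \<le> 2 * (cmod (f x))\<^sup>2 + 2 * (cmod (g x))\<^sup>2" .
qed simp

instantiation ell2 :: (type) real_normed_vector
begin

lift_definition zero_ell2 :: "'a ell2" is "\<lambda>_. 0"
  by simp

lift_definition plus_ell2 :: "'a ell2 \<Rightarrow> 'a ell2 \<Rightarrow> 'a ell2" is "\<lambda>f g x. f x + g x"
  by (rule square_summable_add)

lift_definition uminus_ell2 :: "'a ell2 \<Rightarrow> 'a ell2" is "\<lambda>f x. - f x"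
  by simp

lift_definition minus_ell2 :: "'a ell2 \<Rightarrow> 'a ell2 \<Rightarrow> 'a ell2" is "\<lambda>f g x. f x - g x"
proof -
  fix f g :: "'a \<Rightarrow> complex"
  assume "(\<lambda>x. (cmod (f x))\<^sup>2) summable_on UNIV" "(\<lambda>x. (cmod (g x))\<^sup>2) summable_on UNIV"
  then show "(\<lambda>x. (cmod (f x - g x))\<^sup>2) summable_on UNIV"
    using square_summable_add[of f "\<lambda>x. - g x"] by simp
qed

definition scaleR_ell2 :: "real \<Rightarrow> 'a ell2 \<Rightarrow> 'a ell2"
  where "scaleR_ell2 r f = scaleC_ell2 (complex_of_real r) f"

definition norm_ell2 :: "'a ell2 \<Rightarrow> real"
  where "norm_ell2 f = sqrt (\<Sum>\<^sub>\<infinity>x. (cmod (coord f x))\<^sup>2)"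

definition dist_ell2 :: "'a ell2 \<Rightarrow> 'a ell2 \<Rightarrow> real"
  where "dist_ell2 f g = norm (f - g)"

definition sgn_ell2 :: "'a ell2 \<Rightarrow> 'a ell2"
  where "sgn_ell2 f = inverse (norm f) *\<^sub>R f"

definition uniformity_ell2 :: "('a ell2 \<times> 'a ell2) filter"
  where "uniformity_ell2 = (INF e\<in>{0<..}. principal {(f, g). dist f g < e})"

definition open_ell2 :: "'a ell2 set \<Rightarrow> bool"
  where "open_ell2 U = (\<forall>f\<in>U. eventually (\<lambda>(f', g). f' = f \<longrightarrow> g \<in> U) uniformity)"

instance
proof
  fix f g h :: "'a ell2" and a b :: real
  have summ: "(\<lambda>x. (cmod (coord k x))\<^sup>2) summable_on UNIV" for k :: "'a ell2"
    using coord[of k] by simp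
  show "f + g + h = f + (g + h)" "f + g = g + f" "0 + f = f" "- f + f = 0" "f - g = f + - g"
    by (transfer, simp add: algebra_simps)+
  show "a *\<^sub>R (f + g) = a *\<^sub>R f + a *\<^sub>R g" "(a + b) *\<^sub>R f = a *\<^sub>R f + b *\<^sub>R f"
    "a *\<^sub>R b *\<^sub>R f = (a * b) *\<^sub>R f" "1 *\<^sub>R f = f"
    unfolding scaleR_ell2_def by (transfer, simp add: algebra_simps)+
  show "dist f g = norm (f - g)"
    by (rule dist_ell2_def)
  show "sgn f = inverse (norm f) *\<^sub>R f"
    by (rule sgn_ell2_def)
  show "(uniformity :: ('a ell2 \<times> 'a ell2) filter)
      = (INF e\<in>{0<..}. principal {(x, y). dist x y < e})"
    by (rule uniformity_ell2_def)
  show "open U = (\<forall>x\<in>U. \<forall>\<^sub>F (x', y) in uniformity. x' = x \<longrightarrow> y \<in> U)" for U :: "'a ell2 set"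
    by (rule open_ell2_def)
  show "norm f = 0 \<longleftrightarrow> f = 0"
  proof
    assume "norm f = 0"
    then have "(\<Sum>\<^sub>\<infinity>x. (cmod (coord f x))\<^sup>2) = 0"
      by (simp add: norm_ell2_def)
    then have "(cmod (coord f x))\<^sup>2 = 0" for x
      using nonneg_infsum_le_0D[of "\<lambda>x. (cmod (coord f x))\<^sup>2" UNIV x] summ[of f] by simp
    then show "f = 0"
      by (simp add: coord_inject[symmetric] zero_ell2.rep_eq fun_eq_iff)
  qed (simp add: norm_ell2_def zero_ell2.rep_eq)
  show "norm (a *\<^sub>R f) = \<bar>a\<bar> * norm f"
    by (simp add: norm_ell2_def scaleR_ell2_def scaleC_ell2.rep_eq norm_mult power_mult_distrib
        infsum_cmult_right' real_sqrt_mult)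
  have fin: "L2_set (\<lambda>x. cmod (coord k x)) F \<le> norm k" if "finite F" for k :: "'a ell2" and F
    unfolding L2_set_def norm_ell2_def
    by (intro real_sqrt_le_mono finite_sum_le_infsum summ that) auto
  have "(\<Sum>\<^sub>\<infinity>x. (cmod (coord (f + g) x))\<^sup>2) \<le> (norm f + norm g)\<^sup>2"
  proof (rule infsum_le_finite_sums[OF summ])
    fix F :: "'a set"
    assume F: "finite F" "F \<subseteq> UNIV"
    have "L2_set (\<lambda>x. cmod (coord (f + g) x)) F
        \<le> L2_set (\<lambda>x. cmod (coord f x) + cmod (coord g x)) F"
      by (intro L2_set_mono) (auto simp: plus_ell2.rep_eq norm_triangle_ineq)
    also have "\<dots> \<le> L2_set (\<lambda>x. cmod (coord f x)) F + L2_set (\<lambda>x. cmod (coord g x)) F"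
      by (rule L2_set_triangle_ineq)
    also have "\<dots> \<le> norm f + norm g"
      by (intro add_mono fin F)
    finally show "(\<Sum>x\<in>F. (cmod (coord (f + g) x))\<^sup>2) \<le> (norm f + norm g)\<^sup>2"
      unfolding L2_set_def by (rule sqrt_le_D)
  qed
  moreover have "0 \<le> norm f + norm g"
    unfolding norm_ell2_def by (intro add_nonneg_nonneg real_sqrt_ge_zero infsum_nonneg) auto
  ultimately show "norm (f + g) \<le> norm f + norm g"
    unfolding norm_ell2_def[of "f + g"] by (intro real_le_lsqrt) auto
qed

end

lemma norm_scaleC_ell2: "norm (scaleC_ell2 c f) = cmod c * norm f"
  by (simp add: norm_ell2_def scaleC_ell2.rep_eq norm_mult power_mult_distrib
      infsum_cmult_right' real_sqrt_mult)

lemma bounded_linear_scaleC_ell2: "bounded_linear (scaleC_ell2 c)"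
proof (rule bounded_linear_intro)
  show "scaleC_ell2 c (f + g) = scaleC_ell2 c f + scaleC_ell2 c g" for f g :: "'a ell2"
    by transfer (simp add: algebra_simps)
  show "scaleC_ell2 c (r *\<^sub>R f) = r *\<^sub>R scaleC_ell2 c f" for r and f :: "'a ell2"
    unfolding scaleR_ell2_def by transfer (simp add: algebra_simps)
  show "norm (scaleC_ell2 c f) \<le> norm f * cmod c" for f :: "'a ell2"
    by (simp add: norm_scaleC_ell2)
qed

text \<open>
  Elements of \<^typ>\<open>'a ell2 \<Rightarrow>\<^sub>L 'a ell2\<close> are merely real-linear; \<open>B(\<ell>\<^sup>2)\<close> consists of the
  complex-linear ones, with the same norm.
\<close>

type_synonym 'a oper = "'a ell2 \<Rightarrow>\<^sub>L 'a ell2"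

definition bounded_ops :: "'a oper set" where
  "bounded_ops = {T. \<forall>c f. blinfun_apply T (scaleC_ell2 c f) = scaleC_ell2 c (blinfun_apply T f)}"

definition scaleC_op :: "complex \<Rightarrow> 'a oper \<Rightarrow> 'a oper" where
  "scaleC_op c T = Blinfun (\<lambda>f. scaleC_ell2 c (blinfun_apply T f))"

lemma scaleC_op_apply: "blinfun_apply (scaleC_op c T) f = scaleC_ell2 c (blinfun_apply T f)"
  unfolding scaleC_op_def
  by (simp add: bounded_linear_Blinfun_apply
      bounded_linear_compose[OF bounded_linear_scaleC_ell2 blinfun.bounded_linear_right])

text \<open>
  In a cancellative monoid the family below is absolutely summable by Cauchy--Schwarz, so
  the unordered sum never takes its default value.
\<close>

definition conv :: "'s::monoid_mult ell2 \<Rightarrow> 's ell2 \<Rightarrow> 's \<Rightarrow> complex" where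
  "conv f g s = (\<Sum>\<^sub>\<infinity>(u, v)\<in>{(u, v). u * v = s}. coord f u * coord g v)"

text \<open>
  \<open>is_left_conv f T\<close> says that left convolution by \<open>f\<close> maps \<open>\<ell>\<^sup>2\<close> to itself and is the
  bounded operator \<open>T\<close>. In general \<open>conv f g\<close> need not be square-summable, so
  \<open>L\<^sub>f\<close> is not available as a total function of \<open>f\<close>.
\<close>

definition is_left_conv :: "'s::monoid_mult ell2 \<Rightarrow> 's oper \<Rightarrow> bool" where
  "is_left_conv f T \<longleftrightarrow> (\<forall>g. coord (blinfun_apply T g) = conv f g)"

definition left_conv_algebra :: "'s::monoid_mult oper set" where
  "left_conv_algebra = {T \<in> bounded_ops. \<exists>f. is_left_conv f T}"

definition closed_subalgebra :: "'a oper set \<Rightarrow> bool" where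
  "closed_subalgebra A \<longleftrightarrow> A \<subseteq> bounded_ops \<and> closed A \<and> 0 \<in> A \<and>
     (\<forall>T\<in>A. \<forall>U\<in>A. T + U \<in> A) \<and> (\<forall>c. \<forall>T\<in>A. scaleC_op c T \<in> A) \<and>
     (\<forall>T\<in>A. \<forall>U\<in>A. T o\<^sub>L U \<in> A)"

definition banach_algebra_generated :: "'a oper set \<Rightarrow> 'a oper set" where
  "banach_algebra_generated G = \<Inter>{A. closed_subalgebra A \<and> G \<subseteq> A}"

text \<open>
  For left-cancellative monoids \<open>L\<^sub>s\<close> is an isometry, so there is exactly one \<open>T\<close> for each \<open>s\<close>
  below and the generating set is \<open>{L\<^sub>s | s}\<close>.
\<close>

definition semigroup_banach_algebra :: "'s::monoid_mult oper set" where
  "semigroup_banach_algebra =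
     banach_algebra_generated {T \<in> bounded_ops. \<exists>s. is_left_conv (delta s) T}"

text \<open>
  Hochschild cohomology in degree one of an operator algebra \<open>A\<close> with coefficients in a space of
  operators \<open>X\<close>, both module actions being composition. A map defined on \<open>A\<close> is represented
  by a function on all operators that vanishes outside \<open>A\<close>.
\<close>

definition continuous_derivations :: "'a oper set \<Rightarrow> 'a oper set \<Rightarrow> ('a oper \<Rightarrow> 'a oper) set" where
  "continuous_derivations A X = {D.
     (\<forall>T. T \<notin> A \<longrightarrow> D T = 0) \<and>
     (\<forall>T\<in>A. D T \<in> X) \<and>
     (\<forall>T\<in>A. \<forall>U\<in>A. D (T + U) = D T + D U) \<and>
     (\<forall>c. \<forall>T\<in>A. D (scaleC_op c T) = scaleC_op c (D T)) \<and>
     (\<forall>T\<in>A. \<forall>U\<in>A. D (T o\<^sub>L U) = (T o\<^sub>L D U) + (D T o\<^sub>L U)) \<and>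
     continuous_on A D}"

definition inner_derivation :: "'a oper set \<Rightarrow> 'a oper \<Rightarrow> 'a oper \<Rightarrow> 'a oper" where
  "inner_derivation A M = (\<lambda>T. if T \<in> A then (T o\<^sub>L M) - (M o\<^sub>L T) else 0)"

definition inner_derivations :: "'a oper set \<Rightarrow> 'a oper set \<Rightarrow> ('a oper \<Rightarrow> 'a oper) set" where
  "inner_derivations A X = inner_derivation A ` X"

text \<open>
  The quotient of the continuous derivations by the inner ones; its zero element is the coset of
  the zero derivation, i.e. \<open>inner_derivations A X\<close> itself.
\<close>

definition H1 :: "'a oper set \<Rightarrow> 'a oper set \<Rightarrow> ('a oper \<Rightarrow> 'a oper) set set" where
  "H1 A X = continuous_derivations A X //
     {(D, E). D \<in> continuous_derivations A X \<and> E \<in> continuous_derivations A X \<and>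
              (\<lambda>T. D T - E T) \<in> inner_derivations A X}"

end

theory Submission
  imports Defs
begin

text \<open>
  Write \<open>f\<^sub>s\<close> for the square-summable function whose convolution operator is \<open>D(L\<^sub>s)\<close>. The derivation
  rule reads \<open>f(st) = \<delta>\<^sub>s * f\<^sub>t + f\<^sub>s * \<delta>\<^sub>t\<close>, and continuity of \<open>D\<close> bounds the operator norms of all the
  \<open>D(L\<^sub>s)\<close> by one constant. A symbol \<open>g\<close> with \<open>f\<^sub>s = \<delta>\<^sub>s * g - g * \<delta>\<^sub>s\<close> is wanted.

  No averaging over the monoid is used; the generators \<open>X\<^sub>n\<close> with large \<open>n\<close> do its work. Since
  \<open>X\<^sub>n s = s X\<^bsub>n+|s|\<^esub>\<close> for large \<open>n\<close>, these elements are asymptotically central up to a shift of the index.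
  Evaluating the derivation rule for \<open>X\<^sub>n s = s X\<^bsub>n+|s|\<^esub>\<close> at \<open>X\<^sub>n u\<close> and letting \<open>n\<close> grow, the term
  \<open>f\<^sub>s * \<delta>(X\<^bsub>n+|s|\<^esub>)\<close> disappears when \<open>|u| \<noteq> |s|\<close>, and what is left is the desired identity for
  \<open>g(v) = lim f(X\<^sub>n)(X\<^sub>n v)\<close> (\<open>cocycle_gen_eq_commutator\<close>). The limit exists in the strongest sense: the
  sequence is eventually constant (\<open>cocycle_eventually_constant\<close>), because elements of the monoid have few
  right factors. Only generators \<open>s\<close> need to be considered, so it remains to look at \<open>f\<^sub>s(u)\<close> with \<open>s\<close> and
  \<open>u\<close> generators. These values are zero, in agreement with \<open>g(e) = 0\<close>: the diagonal ones are values of a bounded homomorphism into the complex numbers (\<open>cocycle_diagonal\<close>), the others are killed by the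
  defining relations (\<open>cocycle_gen_gen\<close>).

  Every element has finitely many factorizations, so any finite set of coordinates of \<open>g * h\<close> coincides with
  coordinates of \<open>D(L(X\<^sub>n))\<close> applied to a restriction of \<open>h\<close>, for one large \<open>n\<close>. This makes convolution by
  \<open>g\<close> a bounded operator (\<open>implementing_symbol_bounded\<close>). The commutator with it agrees with \<open>D\<close> on the
  generators, hence on the generated Banach algebra (\<open>closed_subalgebra_commutator\<close>).

  The divisibility facts rest on normal forms of words, on which multiplication by a generator from either
  side acts by an insertion.
\<close>

section \<open>Divisibility in Thompson's monoid\<close>
lift_definition gen :: "nat \<Rightarrow> thompson" is "\<lambda>i. [i]" .

lemma gen_relation: "i < j \<Longrightarrow> gen j * gen i = gen i * gen (Suc j)"
  by transfer (use thompson_step.intros[of _ _ "[]" "[]"] in auto)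

lemma abs_thompson_Nil: "abs_thompson [] = 1"
  by (simp add: one_thompson_def)

lemma abs_thompson_Cons: "abs_thompson (i # w) = gen i * abs_thompson w"
  by (simp add: gen.abs_eq times_thompson.abs_eq)

lemma abs_thompson_append: "abs_thompson (v @ w) = abs_thompson v * abs_thompson w"
  by (simp add: times_thompson.abs_eq)

lemma abs_thompson_singleton: "abs_thompson [i] = gen i"
  by (simp add: gen.abs_eq)

lemma thompson_left_induct [case_names one gen_mult]:
  assumes "P 1" "\<And>i x. P x \<Longrightarrow> P (gen i * x)"
  shows "P x"
proof -
  have "P (abs_thompson w)" for w
    by (induction w) (auto simp: abs_thompson_Nil abs_thompson_Cons assms)
  then show ?thesis
    by (metis Quotient_thompson Quotient_abs_rep)
qed

lemma thompson_right_induct [case_names one mult_gen]: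
  assumes "P 1" "\<And>i x. P x \<Longrightarrow> P (x * gen i)"
  shows "P x"
proof -
  have "P (abs_thompson w)" for w
    by (induction w rule: rev_induct) (auto simp: abs_thompson_Nil abs_thompson_append abs_thompson_singleton assms)
  then show ?thesis
    by (metis Quotient_thompson Quotient_abs_rep)
qed

text \<open>
  A function on words descends to the monoid as soon as it is constant along single rewriting steps.
\<close>
lemma equivclp_invariant:
  assumes "equivclp r x y" "\<And>x y. r x y \<Longrightarrow> f x = f y"
  shows "f x = f y"
  using assms(1) by (induction rule: equivclp_induct) (auto dest: assms(2))

lift_definition word_length :: "thompson \<Rightarrow> nat" is length
  by (erule equivclp_invariant) (auto elim: thompson_step.cases)

lemma word_length_one [simp]: "word_length 1 = 0"
  by transfer simp

lemma word_length_gen [simp]: "word_length (gen i) = 1"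
  by transfer simp

lemma word_length_mult [simp]: "word_length (x * y) = word_length x + word_length y"
  by transfer simp

lemma word_length_eq_0_iff [simp]: "word_length x = 0 \<longleftrightarrow> x = 1"
  by (induction x rule: thompson_left_induct) (auto dest: arg_cong[of _ _ word_length])

lemma word_length_eq_1D:
  assumes "word_length x = 1"
  obtains i where "x = gen i"
  using assms by (induction x rule: thompson_left_induct) auto

text \<open>
  Left multiplication by \<open>X\<^sub>j\<close> on the normal forms \<open>X(i1) X(i2) \<dots>\<close>, \<open>i1 \<le> i2 \<le> \<dots>\<close>: the letter \<open>X\<^sub>j\<close>
  travels to the right past every smaller letter, and its index grows by one each time.
\<close>
fun insert_left :: "nat \<Rightarrow> nat list \<Rightarrow> nat list" where
  "insert_left j [] = [j]"
| "insert_left j (i # r) = (if j \<le> i then j # i # r else i # insert_left (Suc j) r)"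

text \<open>
  The insertions satisfy the defining relations, so words act on lists through the monoid. The
  image of the empty list under an element is its normal form.
\<close>
lemma insert_left_relation: "i < j \<Longrightarrow> insert_left j (insert_left i r) = insert_left i (insert_left (Suc j) r)"
  by (induction r arbitrary: i j) auto

lemma insert_left_eq_iff: "insert_left j r = insert_left j r' \<longleftrightarrow> r = r'"
proof (induction r arbitrary: j r')
  case Nil
  show ?case
    by (cases r'; cases "tl r'") (auto split: if_splits)
next
  case (Cons i r)
  show ?case
    using Cons by (cases r'; cases r) (auto split: if_splits)
qed

lemma set_insert_left: "set (insert_left j r) \<subseteq> insert j (set r) \<union> {j..}"
  by (induction r arbitrary: j) (auto dest!: subsetD, fastforce+)

lemma sorted_insert_left: "sorted r \<Longrightarrow> sorted (insert_left j r)"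
  using set_insert_left by (induction r arbitrary: j) (auto, fastforce)

lift_definition left_nf :: "thompson \<Rightarrow> nat list" is "\<lambda>w. foldr insert_left w []"
  by (erule equivclp_invariant) (auto elim!: thompson_step.cases simp: insert_left_relation)

lemma left_nf_one [simp]: "left_nf 1 = []"
  by transfer simp

lemma left_nf_gen_mult [simp]: "left_nf (gen i * x) = insert_left i (left_nf x)"
  by transfer simp

lemma left_nf_gen [simp]: "left_nf (gen i) = [i]"
  by transfer simp

lemma abs_thompson_insert_left: "abs_thompson (insert_left i r) = gen i * abs_thompson r"
  by (induction r arbitrary: i)
    (auto simp: abs_thompson_Nil abs_thompson_Cons gen_relation simp flip: mult.assoc)

lemma abs_thompson_left_nf: "abs_thompson (left_nf x) = x"
  by (induction x rule: thompson_left_induct) (auto simp: abs_thompson_Nil abs_thompson_insert_left)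

lemma sorted_left_nf: "sorted (left_nf x)"
  by (induction x rule: thompson_left_induct) (auto simp: sorted_insert_left)

lemma left_nf_eq_iff: "left_nf x = left_nf y \<longleftrightarrow> x = y"
  by (metis abs_thompson_left_nf)

text \<open>
  Left multiplication by a generator acts on normal forms as an injective map.
\<close>
lemma thompson_left_cancel: "s * x = s * (y :: thompson) \<longleftrightarrow> x = y"
proof (induction s rule: thompson_left_induct)
  case (gen_mult i s)
  have "gen i * (s * x) = gen i * (s * y) \<longleftrightarrow> s * x = s * y"
    by (simp add: insert_left_eq_iff flip: left_nf_eq_iff)
  with gen_mult show ?case
    by (simp add: mult.assoc)
qed simp

lemma gen_mult_gen_eq_iff:
  "gen a * gen b = gen c * gen d \<longleftrightarrow>
   (if a \<le> b then [a, b] else [b, Suc a]) = (if c \<le> d then [c, d] else [d, Suc c])"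
  by (simp flip: left_nf_eq_iff)

text \<open>
  The combinatorial form of the next lemma. Sortedness of \<open>r\<close> is what allows a leading letter \<open>i\<close>
  of \<open>r\<close> to be read as the result of inserting \<open>i\<close>.
\<close>
lemma insert_left_eq_insert_left:
  assumes "insert_left n r = insert_left i q" "i < n" "sorted r"
  shows "\<exists>p. r = insert_left i p"
  using assms
proof (induction q arbitrary: n i r)
  case Nil
  then show ?case
    by (cases r; cases "tl r") (auto split: if_splits)
next
  case (Cons a q)
  show ?case
  proof (cases "i \<le> a")
    case True
    with Cons.prems obtain r' where "r = i # r'"
      by (cases r) (auto split: if_splits)
    with Cons.prems have "r = insert_left i r'"
      by (cases r') auto
    then show ?thesis ..
  next
    case False
    with Cons.prems obtain r' where r: "r = a # r'" and eq: "insert_left (Suc n) r' = insert_left (Suc i) q"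
      by (cases r) (auto split: if_splits)
    from Cons.IH[OF eq] Cons.prems r obtain p where "r' = insert_left (Suc i) p"
      by auto
    with r False have "r = insert_left i (a # p)"
      by simp
    then show ?thesis ..
  qed
qed

text \<open>
  For \<open>i < n\<close> the least common right multiple of \<open>X\<^sub>n\<close> and \<open>X\<^sub>i\<close> is \<open>X\<^sub>n X\<^sub>i = X\<^sub>i X\<^bsub>n+1\<^esub>\<close>, so a
  left factor \<open>X\<^sub>i\<close> of \<open>X\<^sub>n u\<close> already sits in \<open>u\<close>.
\<close>
lemma gen_mult_eq_gen_multD:
  assumes "gen n * u = gen i * w" "i < n"
  obtains u' where "u = gen i * u'"
proof -
  have "insert_left n (left_nf u) = insert_left i (left_nf w)"
    using assms by (simp flip: left_nf_eq_iff)
  from insert_left_eq_insert_left[OF this \<open>i < n\<close> sorted_left_nf] obtain p where "left_nf u = insert_left i p" ..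
  then have "u = gen i * abs_thompson p"
    by (metis abs_thompson_insert_left abs_thompson_left_nf)
  with that show ?thesis .
qed

text \<open>
  Right multiplication by \<open>X\<^sub>j\<close> on normal forms that are stored in reverse, last letter first: the
  letter \<open>X\<^sub>j\<close> travels to the left past every larger letter, whose index grows by one.
\<close>
fun insert_right :: "nat \<Rightarrow> nat list \<Rightarrow> nat list" where
  "insert_right j [] = [j]"
| "insert_right j (i # r) = (if i \<le> j then j # i # r else Suc i # insert_right j r)"

lemma insert_right_relation: "i < j \<Longrightarrow> insert_right i (insert_right j r) = insert_right (Suc j) (insert_right i r)"
  by (induction r arbitrary: i j) auto

lemma insert_right_eq_iff: "insert_right j r = insert_right j r' \<longleftrightarrow> r = r'"
proof (induction r arbitrary: j r')
  case Nil
  show ?case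
    by (cases r'; cases "tl r'") (auto split: if_splits)
next
  case (Cons i r)
  show ?case
    using Cons by (cases r'; cases r) (auto split: if_splits)
qed

lemma mem_insert_right: "j \<in> set (insert_right j r)"
  by (induction r) auto

lift_definition right_nf :: "thompson \<Rightarrow> nat list" is "\<lambda>w. fold insert_right w []"
  by (erule equivclp_invariant) (auto elim!: thompson_step.cases simp: insert_right_relation)

lemma right_nf_one [simp]: "right_nf 1 = []"
  by transfer simp

lemma right_nf_mult_gen [simp]: "right_nf (x * gen i) = insert_right i (right_nf x)"
  by transfer simp

lemma abs_thompson_insert_right: "abs_thompson (rev (insert_right i r)) = abs_thompson (rev r) * gen i"
  by (induction r)
    (auto simp: abs_thompson_Nil abs_thompson_append abs_thompson_Cons gen_relation mult.assoc)

lemma abs_thompson_right_nf: "abs_thompson (rev (right_nf x)) = x"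
  by (induction x rule: thompson_right_induct) (auto simp: abs_thompson_Nil abs_thompson_insert_right)

lemma right_nf_eq_iff: "right_nf x = right_nf y \<longleftrightarrow> x = y"
  by (metis abs_thompson_right_nf)

lemma thompson_right_cancel: "x * s = y * (s :: thompson) \<longleftrightarrow> x = y"
proof (induction s rule: thompson_right_induct)
  case (mult_gen i s)
  have "(x * s) * gen i = (y * s) * gen i \<longleftrightarrow> x * s = y * s"
    by (simp add: insert_right_eq_iff flip: right_nf_eq_iff)
  with mult_gen show ?case
    by (simp add: mult.assoc)
qed simp

lemma insert_right_eq_insert_right:
  assumes "insert_right N r = insert_right k q" "k < N"
  shows "Suc k < N \<and> (\<exists>p. r = insert_right k p)"
  using assms
proof (induction q arbitrary: r)
  case Nil
  then show ?case
    by (cases r; cases "tl r") (auto split: if_splits)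
next
  case (Cons a q)
  show ?case
  proof (cases r)
    case Nil
    with Cons.prems show ?thesis
      by (cases q) (auto split: if_splits)
  next
    case r: (Cons b r')
    show ?thesis
    proof (cases "b \<le> N")
      case True
      with Cons.prems r show ?thesis
        by (auto split: if_splits)
    next
      case False
      with Cons.prems r have "insert_right N r' = insert_right k q"
        by (auto split: if_splits)
      from Cons.IH[OF this] Cons.prems obtain p where "Suc k < N" "r' = insert_right k p"
        by auto
      with r False have "r = insert_right k ((b - 1) # p)"
        by auto
      with \<open>Suc k < N\<close> show ?thesis
        by blast
    qed
  qed
qed

text \<open>
  Two different right factors \<open>X\<^sub>N\<close> and \<open>X\<^sub>k\<close>, \<open>k < N\<close>, are compatible only through the relation
  \<open>X\<^sub>k X\<^sub>N = X\<^bsub>N-1\<^esub> X\<^sub>k\<close>. In particular \<open>X\<^bsub>k+1\<^esub>\<close> and \<open>X\<^sub>k\<close> have no common left multiple.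
\<close>
lemma mult_gen_eq_mult_genD:
  assumes "u * gen N = v * gen k" "k < N"
  obtains t where "u = t * gen k" "v = t * gen (N - 1)"
proof -
  have "insert_right N (right_nf u) = insert_right k (right_nf v)"
    using assms by (simp flip: right_nf_eq_iff)
  from insert_right_eq_insert_right[OF this \<open>k < N\<close>] obtain p
    where N: "Suc k < N" and "right_nf u = insert_right k p"
    by blast
  then have u: "u = abs_thompson (rev p) * gen k"
    by (metis abs_thompson_insert_right abs_thompson_right_nf)
  have "v * gen k = abs_thompson (rev p) * gen (N - 1) * gen k"
    using assms(1) gen_relation[of k "N - 1"] N by (simp add: u mult.assoc)
  then have "v = abs_thompson (rev p) * gen (N - 1)"
    by (simp add: thompson_right_cancel)
  with u show ?thesis
    by (rule that)
qed

text \<open>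
  Inserting \<open>k\<close> on the right leaves the letter \<open>k\<close> itself in the list; only the letters that it
  passes are changed.
\<close>
lemma finite_right_factors: "finite {k. \<exists>x'. x = x' * gen k}"
proof (rule finite_subset)
  show "{k. \<exists>x'. x = x' * gen k} \<subseteq> set (right_nf x)"
    using mem_insert_right by auto
qed simp

lemma eventually_not_right_factor: "\<forall>\<^sub>F k in sequentially. \<forall>x'. x \<noteq> x' * gen k"
  using finite_right_factors[of x]
  by (simp add: eventually_cofinite flip: cofinite_eq_sequentially)

text \<open>
  A non-trivial right factor of \<open>x\<close> ends in one of the finitely many generators that divide \<open>x\<close> on
  the right; removing it gives a factorization of a shorter element.
\<close>
lemma finite_factorizations_thompson: "finite {(u, v). u * v = (x :: thompson)}"
proof (induction "word_length x" arbitrary: x)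
  case 0
  then have "{(u, v). u * v = x} \<subseteq> {(1, 1)}"
    by (auto simp flip: word_length_eq_0_iff)
  then show ?case
    by (rule finite_subset) simp
next
  case (Suc n)
  define K where "K = {k. \<exists>x'. x = x' * gen k}"
  define q where "q k = (THE x'. x = x' * gen k)" for k
  have q: "q k = x'" if "x = x' * gen k" for k x'
    unfolding q_def using that by (auto simp: thompson_right_cancel)
  have "{(u, v). u * v = x} \<subseteq>
      insert (x, 1) (\<Union>k\<in>K. (\<lambda>(u, v). (u, v * gen k)) ` {(u, v). u * v = q k})"
  proof clarify
    fix u v :: thompson
    assume "(u, v) \<notin> (\<Union>k\<in>K. (\<lambda>(u, v). (u, v * gen k)) ` {(u, v). u * v = q k})"
      and x: "x = u * v"
    then show "u = u * v \<and> v = 1"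
    proof (induction v rule: thompson_right_induct)
      case (mult_gen k v)
      then have x: "x = (u * v) * gen k"
        by (simp add: mult.assoc)
      then have "k \<in> K" "u * v = q k"
        using q[OF x] by (auto simp: K_def)
      with mult_gen(2) show ?case
        by force
    qed simp
  qed
  moreover have "finite {(u, v). u * v = q k}" if "k \<in> K" for k
  proof (rule Suc(1))
    from that obtain x' where "x = x' * gen k"
      by (auto simp: K_def)
    with Suc(2) q[of x' k] show "n = word_length (q k)"
      by simp
  qed
  moreover have "finite K"
    unfolding K_def by (rule finite_right_factors)
  ultimately show ?case
    by (elim finite_subset) simp
qed

text \<open>
  A letter with a large index passes through the whole of \<open>u\<close>. This makes \<open>X\<^sub>n\<close> behave for large \<open>n\<close>
  like an element that commutes with everything, up to a shift of its index.
\<close>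
lemma eventually_gen_mult: "\<forall>\<^sub>F n in sequentially. gen n * u = u * gen (n + word_length u)"
proof (induction u rule: thompson_right_induct)
  case (mult_gen i u)
  then show ?case
    using eventually_gt_at_top[of i]
  proof eventually_elim
    case (elim n)
    then have "gen n * (u * gen i) = u * (gen (n + word_length u) * gen i)"
      by (simp flip: mult.assoc)
    also have "\<dots> = u * gen i * gen (n + word_length (u * gen i))"
      using elim gen_relation[of i "n + word_length u"] by (simp add: mult.assoc)
    finally show ?case .
  qed
qed simp

lemma eventually_shift: "eventually P sequentially \<Longrightarrow> \<forall>\<^sub>F n in sequentially. P (n + k)"
  by (rule eventually_all_ge_at_top[THEN eventually_mono]) auto

text \<open>
  For large \<open>n\<close> the factorizations of \<open>X\<^sub>n u\<close> with a prescribed right factor are those of \<open>u\<close>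
  with \<open>X\<^sub>n\<close> put in front. The proof strips \<open>w\<close> letter by letter from the right, reading
  \<open>X\<^sub>n u\<close> as \<open>u X\<^bsub>n+|u|\<^esub>\<close>.
\<close>
lemma eventually_gen_mult_factor:
  "\<forall>\<^sub>F n in sequentially. \<forall>v. gen n * u = v * w \<longrightarrow> (\<exists>v'. v = gen n * v' \<and> u = v' * w)"
proof (induction w arbitrary: u rule: thompson_right_induct)
  case (mult_gen k w)
  show ?case
  proof (cases "\<exists>u'. u = u' * gen k")
    case True
    then obtain u' where u: "u = u' * gen k" ..
    from mult_gen[of u'] show ?thesis
    proof eventually_elim
      case (elim n)
      show ?case
      proof clarify
        fix v assume "gen n * u = v * (w * gen k)"
        then have "gen n * u' = v * w"
          unfolding u by (simp add: thompson_right_cancel flip: mult.assoc)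
        with elim obtain v' where "v = gen n * v'" "u' = v' * w"
          by blast
        then show "\<exists>v'. v = gen n * v' \<and> u = v' * (w * gen k)"
          by (auto simp: u mult.assoc)
      qed
    qed
  next
    case False
    show ?thesis
      using eventually_gen_mult[of u] eventually_gt_at_top[of k]
    proof eventually_elim
      case (elim n)
      show ?case
      proof clarify
        fix v assume "gen n * u = v * (w * gen k)"
        with elim have "u * gen (n + word_length u) = v * w * gen k" "k < n + word_length u"
          by (simp_all add: mult.assoc)
        then obtain t where "u = t * gen k"
          by (rule mult_gen_eq_mult_genD)
        with False show "\<exists>v'. v = gen n * v' \<and> u = v' * (w * gen k)"
          by blast
      qed
    qed
  qed
qed auto

text \<open>
  Here \<open>X\<^sub>n u = u X\<^bsub>n+|u|\<^esub>\<close>. If this also ends in \<open>X\<^bsub>n+m\<^esub>\<close> with \<open>m \<noteq> |u|\<close>, then \<open>u\<close> is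
  forced to end in a generator whose index grows with \<open>n\<close>.
\<close>
lemma eventually_gen_mult_not_right_factor:
  assumes "word_length u \<noteq> m"
  shows "\<forall>\<^sub>F n in sequentially. \<forall>v. gen n * u \<noteq> v * gen (n + m)"
  using eventually_gen_mult[of u]
    eventually_shift[OF eventually_not_right_factor[of u], of m]
    eventually_shift[OF eventually_not_right_factor[of u], of "m - 1"]
proof eventually_elim
  case (elim n)
  show ?case
  proof (intro allI notI)
    fix v assume "gen n * u = v * gen (n + m)"
    with elim have eq: "u * gen (n + word_length u) = v * gen (n + m)"
      by simp
    show False
    proof (cases "m < word_length u")
      case True
      with eq elim(2) show False
        by (metis add_less_cancel_left mult_gen_eq_mult_genD)
    next
      case False
      with assms have "n + word_length u < n + m"
        by simp
      with eq[symmetric] obtain t where "u = t * gen (n + m - 1)"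
        by (rule mult_gen_eq_mult_genD)
      with elim(3)[rule_format, of t] False assms show False
        by simp
    qed
  qed
qed

section \<open>Convolution of functions on a monoid with finite factorizations\<close>
text \<open>
  Finiteness of the factorizations turns convolution into a finite sum. It is therefore defined and
  associative for arbitrary functions, and depends continuously on each factor pointwise.
\<close>
class finite_factorization_monoid = monoid_mult +
  assumes finite_factorizations: "finite {(u, v). u * v = x}"
    and left_cancel: "s * x = s * y \<Longrightarrow> x = y"
    and right_cancel: "x * s = y * s \<Longrightarrow> x = y"

instance thompson :: finite_factorization_monoid
  by standard (simp_all add: finite_factorizations_thompson thompson_left_cancel
      thompson_right_cancel)

definition fconv :: "('s::monoid_mult \<Rightarrow> complex) \<Rightarrow> ('s \<Rightarrow> complex) \<Rightarrow> 's \<Rightarrow> complex"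
    (infixl \<open>\<star>\<close> 70) where
  "(a \<star> b) x = (\<Sum>(u, v)\<in>{(u, v). u * v = x}. a u * b v)"

lemma conv_eq_fconv:
  fixes f g :: "'s::finite_factorization_monoid ell2"
  shows "conv f g = coord f \<star> coord g"
  by (simp add: fun_eq_iff conv_def fconv_def finite_factorizations)

lemma fconv_assoc:
  fixes a b c :: "'s::finite_factorization_monoid \<Rightarrow> complex"
  shows "(a \<star> b) \<star> c = a \<star> (b \<star> c)"
proof
  fix x
  let ?F = "\<lambda>x :: 's. {(u, v). u * v = x}"
  have "((a \<star> b) \<star> c) x = (\<Sum>p\<in>?F x. \<Sum>q\<in>?F (fst p). a (fst q) * b (snd q) * c (snd p))"
    by (simp add: fconv_def case_prod_beta sum_distrib_right)
  also have "\<dots> = (\<Sum>(p, q)\<in>Sigma (?F x) (\<lambda>p. ?F (fst p)). a (fst q) * b (snd q) * c (snd p))"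
    by (rule sum.Sigma) (auto simp: finite_factorizations)
  also have "\<dots> = (\<Sum>(p, q)\<in>Sigma (?F x) (\<lambda>p. ?F (snd p)). a (fst p) * (b (fst q) * c (snd q)))"
    by (rule sum.reindex_bij_witness[where
          i = "\<lambda>((u, _), (v, w)). ((u * v, w), (u, v))" and
          j = "\<lambda>((_, w), (u, v)). ((u, v * w), (v, w))"]) (auto simp: mult.assoc)
  also have "\<dots> = (\<Sum>p\<in>?F x. \<Sum>q\<in>?F (snd p). a (fst p) * (b (fst q) * c (snd q)))"
    by (rule sum.Sigma[symmetric]) (auto simp: finite_factorizations)
  also have "\<dots> = (a \<star> (b \<star> c)) x"
    by (simp add: fconv_def case_prod_beta sum_distrib_left)
  finally show "((a \<star> b) \<star> c) x = (a \<star> (b \<star> c)) x" .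
qed

lemma fconv_add_left: "((\<lambda>x. a x + b x) \<star> c) x = (a \<star> c) x + (b \<star> c) x"
  by (simp add: fconv_def case_prod_beta distrib_right sum.distrib)

lemma fconv_cmult_left: "((\<lambda>x. k * a x) \<star> c) x = k * (a \<star> c) x"
  by (simp add: fconv_def case_prod_beta sum_distrib_left mult.assoc)

lemma fconv_add_right: "(a \<star> (\<lambda>x. b x + c x)) x = (a \<star> b) x + (a \<star> c) x"
  by (simp add: fconv_def case_prod_beta distrib_left sum.distrib)

lemma fconv_cmult_right: "(a \<star> (\<lambda>x. k * b x)) x = k * (a \<star> b) x"
  by (simp add: fconv_def case_prod_beta sum_distrib_left mult_ac)

abbreviation pt :: "'s \<Rightarrow> 's \<Rightarrow> complex" where
  "pt s \<equiv> coord (delta s)"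

lemma pt_apply: "pt s x = (if x = s then 1 else 0)"
  by (rule delta.rep_eq[THEN fun_cong])

lemma fconv_pt_left [simp]:
  fixes b :: "'s::finite_factorization_monoid \<Rightarrow> complex"
  shows "(pt s \<star> b) (s * y) = b y"
proof -
  have "(pt s \<star> b) (s * y) = (\<Sum>(u, v)\<in>{(s, y)}. pt s u * b v)"
    unfolding fconv_def
    by (rule sum.mono_neutral_right)
      (auto simp: finite_factorizations pt_apply dest: left_cancel split: if_splits)
  then show ?thesis
    by (simp add: pt_apply)
qed

lemma fconv_pt_left_eq_0: "(\<And>y. x \<noteq> s * y) \<Longrightarrow> (pt s \<star> b) x = 0"
  unfolding fconv_def by (rule sum.neutral) (auto simp: pt_apply)

lemma fconv_pt_right [simp]:
  fixes a :: "'s::finite_factorization_monoid \<Rightarrow> complex"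
  shows "(a \<star> pt s) (y * s) = a y"
proof -
  have "(a \<star> pt s) (y * s) = (\<Sum>(u, v)\<in>{(y, s)}. a u * pt s v)"
    unfolding fconv_def
    by (rule sum.mono_neutral_right)
      (auto simp: finite_factorizations pt_apply dest: right_cancel split: if_splits)
  then show ?thesis
    by (simp add: pt_apply)
qed

lemma fconv_pt_right_eq_0: "(\<And>y. x \<noteq> y * s) \<Longrightarrow> (a \<star> pt s) x = 0"
  unfolding fconv_def by (rule sum.neutral) (auto simp: pt_apply)

lemma fconv_pt_one [simp]:
  fixes a :: "'s::finite_factorization_monoid \<Rightarrow> complex"
  shows "pt 1 \<star> a = a" "a \<star> pt 1 = a"
  using fconv_pt_left[of 1 a] fconv_pt_right[of a 1] by auto

lemma fconv_pt_pt [simp]: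
  fixes s t :: "'s::finite_factorization_monoid"
  shows "pt s \<star> pt t = pt (s * t)"
proof
  fix x show "(pt s \<star> pt t) x = pt (s * t) x"
  proof (cases "\<exists>y. x = s * y")
    case True
    then show ?thesis
      by (auto simp: pt_apply dest: left_cancel)
  next
    case False
    then have "(pt s \<star> pt t) x = 0" "x \<noteq> s * t"
      by (auto intro: fconv_pt_left_eq_0)
    then show ?thesis
      by (simp add: pt_apply)
  qed
qed

section \<open>Operators given by left convolution\<close>
lemma coord_add: "coord (f + g) x = coord f x + coord g x"
  by (simp add: plus_ell2.rep_eq)

lemma coord_diff: "coord (f - g) x = coord f x - coord g x"
  by (simp add: minus_ell2.rep_eq)

lemma sum_coord_le_norm:
  assumes "finite E"
  shows "(\<Sum>x\<in>E. (cmod (coord f x))\<^sup>2) \<le> (norm f)\<^sup>2"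
proof -
  have "(\<lambda>x. (cmod (coord f x))\<^sup>2) summable_on UNIV"
    using coord[of f] by simp
  then have "(\<Sum>x\<in>E. (cmod (coord f x))\<^sup>2) \<le> (\<Sum>\<^sub>\<infinity>x. (cmod (coord f x))\<^sup>2)"
    by (rule finite_sum_le_infsum) (use assms in auto)
  also have "\<dots> = (norm f)\<^sup>2"
    by (simp add: norm_ell2_def infsum_nonneg)
  finally show ?thesis .
qed

lemma cmod_coord_le_norm: "cmod (coord f x) \<le> norm f"
  using sum_coord_le_norm[of "{x}" f] by (simp add: power_mono_iff)

lemma bounded_linear_coord: "bounded_linear (\<lambda>f. coord f x)"
  by (rule bounded_linear_intro[of _ 1])
    (simp_all add: coord_add scaleR_ell2_def scaleC_ell2.rep_eq cmod_coord_le_norm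
      scaleR_conv_of_real)

lemma ell2_of_bounded_sums:
  assumes "0 \<le> c" "\<And>E. finite E \<Longrightarrow> (\<Sum>x\<in>E. (cmod (a x))\<^sup>2) \<le> c\<^sup>2"
  obtains f where "coord f = a" "norm f \<le> c"
proof -
  have "(\<lambda>x. (cmod (a x))\<^sup>2) summable_on UNIV"
    by (rule nonneg_bdd_above_summable_on) (auto intro!: bdd_aboveI2[of _ _ "c\<^sup>2"] assms(2))
  then have coord: "coord (Abs_ell2 a) = a" and
    "(\<Sum>\<^sub>\<infinity>x. (cmod (a x))\<^sup>2) \<le> c\<^sup>2"
    by (auto simp: Abs_ell2_inverse intro!: infsum_le_finite_sums assms(2))
  then have "norm (Abs_ell2 a) \<le> c"
    by (simp add: norm_ell2_def real_le_lsqrt assms(1))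
  with coord show ?thesis
    by (rule that)
qed

lemma norm_delta [simp]: "norm (delta s) = 1"
proof -
  have "(\<Sum>\<^sub>\<infinity>x. (cmod (pt s x))\<^sup>2) = (\<Sum>\<^sub>\<infinity>x\<in>{s}. 1)"
    by (rule infsum_cong_neutral) (auto simp: pt_apply)
  then show ?thesis
    by (simp add: norm_ell2_def)
qed

lemma bounded_opsD:
  "T \<in> bounded_ops \<Longrightarrow> blinfun_apply T (scaleC_ell2 c f) = scaleC_ell2 c (blinfun_apply T f)"
  by (simp add: bounded_ops_def)

lemma closed_bounded_ops: "closed (bounded_ops :: 'a oper set)"
proof -
  have "continuous_on UNIV (\<lambda>T :: 'a oper. blinfun_apply T f)" for f
    by (intro continuous_intros)
  moreover have "continuous_on UNIV (\<lambda>T :: 'a oper. scaleC_ell2 c (blinfun_apply T f))" for c f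
    by (intro bounded_linear.continuous_on[OF bounded_linear_scaleC_ell2] continuous_intros)
  ultimately show ?thesis
    unfolding bounded_ops_def by (intro closed_Collect_all closed_Collect_eq)
qed

text \<open>
  The function \<open>f\<close> with \<open>T = L\<^sub>f\<close> when \<open>T\<close> is a left convolution operator; it is recovered by
  applying \<open>T\<close> to the unit of the convolution.
\<close>
definition symbol :: "'s::monoid_mult oper \<Rightarrow> 's \<Rightarrow> complex" where
  "symbol T = coord (blinfun_apply T (delta 1))"

lemma left_conv_algebra_iff:
  fixes T :: "'s::finite_factorization_monoid oper"
  shows "T \<in> left_conv_algebra \<longleftrightarrow>
    T \<in> bounded_ops \<and> (\<forall>h. coord (blinfun_apply T h) = symbol T \<star> coord h)"
proof -
  have "coord f = symbol T" if "is_left_conv f T" for f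
    using that by (simp add: is_left_conv_def symbol_def conv_eq_fconv)
  then show ?thesis
    unfolding left_conv_algebra_def is_left_conv_def conv_eq_fconv
    by (auto simp: symbol_def)
qed

lemma coord_left_conv:
  fixes T :: "'s::finite_factorization_monoid oper"
  assumes "T \<in> left_conv_algebra"
  shows "coord (blinfun_apply T h) = symbol T \<star> coord h"
  using assms by (simp add: left_conv_algebra_iff)

lemma symbol_inject:
  fixes T U :: "'s::finite_factorization_monoid oper"
  assumes "T \<in> left_conv_algebra" "U \<in> left_conv_algebra" "symbol T = symbol U"
  shows "T = U"
  by (rule blinfun_eqI) (simp add: assms coord_left_conv flip: coord_inject)

lemma symbol_add: "symbol (T + U) = (\<lambda>x. symbol T x + symbol U x)"
  by (simp add: symbol_def blinfun.add_left coord_add fun_eq_iff)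

lemma symbol_diff: "symbol (T - U) = (\<lambda>x. symbol T x - symbol U x)"
  by (simp add: symbol_def blinfun.diff_left coord_diff fun_eq_iff)

lemma symbol_scaleC: "symbol (scaleC_op c T) = (\<lambda>x. c * symbol T x)"
  by (simp add: symbol_def scaleC_op_apply scaleC_ell2.rep_eq)

lemma symbol_compose:
  fixes T :: "'s::finite_factorization_monoid oper"
  assumes "T \<in> left_conv_algebra"
  shows "symbol (T o\<^sub>L U) = symbol T \<star> symbol U"
  using coord_left_conv[OF assms, of "blinfun_apply U (delta 1)"]
  by (simp add: symbol_def[of "T o\<^sub>L U"] symbol_def[of U])

lemma cmod_symbol_le_norm: "cmod (symbol T x) \<le> norm T"
proof -
  have "cmod (symbol T x) \<le> norm (blinfun_apply T (delta 1))"
    unfolding symbol_def by (rule cmod_coord_le_norm)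
  also have "\<dots> \<le> norm T"
    using norm_blinfun[of T "delta 1"] by simp
  finally show ?thesis .
qed

text \<open>
  Being the convolution by one's own symbol is a family of equations between coordinates. Each of
  them involves finitely many coordinates and is thus preserved by norm limits.
\<close>
lemma closed_left_conv_algebra:
  "closed (left_conv_algebra :: 's::finite_factorization_monoid oper set)"
proof -
  let ?S = "{T :: 's oper. \<forall>h x. coord (blinfun_apply T h) x = (symbol T \<star> coord h) x}"
  have "continuous_on UNIV (\<lambda>T :: 's oper. coord (blinfun_apply T h) x)" for h x
    by (intro bounded_linear.continuous_on[OF bounded_linear_coord] continuous_intros)
  then have "closed ?S"
    unfolding fconv_def symbol_def case_prod_beta
    by (intro closed_Collect_all closed_Collect_eq continuous_intros)
  with closed_bounded_ops have "closed (bounded_ops \<inter> ?S)"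
    by (rule closed_Int)
  also have "bounded_ops \<inter> ?S = left_conv_algebra"
    by (auto simp: left_conv_algebra_iff fun_eq_iff)
  finally show ?thesis .
qed

lemma closed_subalgebra_left_conv_algebra:
  "closed_subalgebra (left_conv_algebra :: 's::finite_factorization_monoid oper set)"
  unfolding closed_subalgebra_def
proof (intro conjI ballI allI)
  show "left_conv_algebra \<subseteq> (bounded_ops :: 's oper set)"
    by (auto simp: left_conv_algebra_def)
  show "closed (left_conv_algebra :: 's oper set)"
    by (rule closed_left_conv_algebra)
  show "0 \<in> (left_conv_algebra :: 's oper set)"
    by (auto simp: left_conv_algebra_iff bounded_ops_def symbol_def zero_ell2.rep_eq fconv_def
        fun_eq_iff scaleC_ell2.rep_eq simp flip: coord_inject)
next
  fix T U :: "'s oper" and c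
  assume T: "T \<in> left_conv_algebra" and U: "U \<in> left_conv_algebra"
  note b = T[unfolded left_conv_algebra_iff, THEN conjunct1, THEN bounded_opsD]
    U[unfolded left_conv_algebra_iff, THEN conjunct1, THEN bounded_opsD]
  note c = coord_left_conv[OF T] coord_left_conv[OF U]
  show "T + U \<in> left_conv_algebra"
    by (auto simp: left_conv_algebra_iff bounded_ops_def blinfun.add_left b c symbol_add
        plus_ell2.rep_eq scaleC_ell2.rep_eq fconv_add_left fun_eq_iff algebra_simps
        simp flip: coord_inject)
  show "T o\<^sub>L U \<in> left_conv_algebra"
    by (auto simp: left_conv_algebra_iff bounded_ops_def b c symbol_compose[OF T] fconv_assoc)
  show "scaleC_op c T \<in> left_conv_algebra"
    by (auto simp: left_conv_algebra_iff bounded_ops_def b c symbol_scaleC scaleC_op_apply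
        scaleC_ell2.rep_eq fconv_cmult_left fun_eq_iff mult_ac
        simp flip: coord_inject)
qed

lemma closed_subalgebra_diff:
  assumes "closed_subalgebra A" "T \<in> A" "U \<in> A"
  shows "T - U \<in> A"
proof -
  have "scaleC_op (-1) U = - U"
    by (rule blinfun_eqI)
      (simp add: scaleC_op_apply blinfun.minus_left scaleC_ell2.rep_eq uminus_ell2.rep_eq
        fun_eq_iff flip: coord_inject)
  with assms show ?thesis
    unfolding closed_subalgebra_def diff_conv_add_uminus by metis
qed

text \<open>
  The bound on finite partial sums provides both the square-summability of the convolutions and the
  boundedness of the operator; that \<open>a\<close> itself is square-summable is the case \<open>h = \<delta>\<^sub>e\<close>.
\<close>
lemma left_conv_of_bounded_sums:
  fixes a :: "'s::finite_factorization_monoid \<Rightarrow> complex"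
  assumes "0 \<le> c"
    and bound: "\<And>E h. finite E \<Longrightarrow>
      (\<Sum>x\<in>E. (cmod ((a \<star> coord h) x))\<^sup>2) \<le> (c * norm (h :: 's ell2))\<^sup>2"
  obtains T where "T \<in> left_conv_algebra" "symbol T = a" "norm T \<le> c"
proof -
  have "\<exists>f. coord f = a \<star> coord h \<and> norm f \<le> c * norm h" for h :: "'s ell2"
    by (rule ell2_of_bounded_sums[of "c * norm h"])
      (use assms in auto)
  then obtain t where t: "\<And>h. coord (t h) = a \<star> coord h" "\<And>h. norm (t h) \<le> c * norm h"
    by metis
  have "bounded_linear t"
    by (rule bounded_linear_intro[of _ c])
      (use t(2) in \<open>auto simp: t(1) plus_ell2.rep_eq scaleR_ell2_def scaleC_ell2.rep_eq
        fconv_add_right fconv_cmult_right fun_eq_iff mult.commute simp flip: coord_inject\<close>)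
  then have app: "blinfun_apply (Blinfun t) = t"
    by (rule bounded_linear_Blinfun_apply)
  have symbol: "symbol (Blinfun t) = a"
    by (simp add: symbol_def app t)
  moreover have "Blinfun t \<in> left_conv_algebra"
    unfolding left_conv_algebra_iff symbol
    by (simp add: bounded_ops_def app t scaleC_ell2.rep_eq fconv_cmult_right fun_eq_iff
        flip: coord_inject)
  moreover have "norm (Blinfun t) \<le> c"
    using assms(1) t(2) by (intro norm_blinfun_bound) (auto simp: app)
  ultimately show ?thesis
    using that by blast
qed

text \<open>
  By left cancellation, convolution by \<open>\<delta>\<^sub>s\<close> only moves coordinates around.
\<close>
lemma ex_left_translation:
  fixes s :: "'s::finite_factorization_monoid"
  shows "\<exists>T \<in> left_conv_algebra. symbol T = pt s \<and> norm T \<le> 1"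
proof -
  have "(\<Sum>x\<in>E. (cmod ((pt s \<star> coord h) x))\<^sup>2) \<le> (1 * norm h)\<^sup>2"
    if "finite E" for E and h :: "'s ell2"
  proof -
    define Y where "Y = {y. s * y \<in> E}"
    have inj: "inj_on ((*) s) Y"
      by (auto intro: inj_onI left_cancel)
    have "finite ((*) s ` Y)"
      by (rule finite_subset[OF _ that]) (auto simp: Y_def)
    with inj have "finite Y"
      by (simp add: finite_image_iff)
    have "(\<Sum>x\<in>E. (cmod ((pt s \<star> coord h) x))\<^sup>2) =
        (\<Sum>x\<in>(*) s ` Y. (cmod ((pt s \<star> coord h) x))\<^sup>2)"
      by (rule sum.mono_neutral_right) (auto simp: that Y_def intro!: fconv_pt_left_eq_0)
    also have "\<dots> = (\<Sum>y\<in>Y. (cmod (coord h y))\<^sup>2)"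
      by (simp add: sum.reindex inj)
    also have "\<dots> \<le> (norm h)\<^sup>2"
      by (rule sum_coord_le_norm) fact
    finally show ?thesis
      by simp
  qed
  then show ?thesis
    by (metis left_conv_of_bounded_sums zero_le_one)
qed

definition left_mult :: "'s::finite_factorization_monoid \<Rightarrow> 's oper" where
  "left_mult s = (SOME T. T \<in> left_conv_algebra \<and> symbol T = pt s \<and> norm T \<le> 1)"

lemma left_mult_in_left_conv_algebra: "left_mult s \<in> left_conv_algebra"
  and symbol_left_mult [simp]: "symbol (left_mult s) = pt s"
  and norm_left_mult_le: "norm (left_mult s) \<le> 1"
  using someI_ex[OF ex_left_translation[unfolded Bex_def, of s]] unfolding left_mult_def by blast+

lemma left_mult_mult: "left_mult (s * t) = left_mult s o\<^sub>L left_mult t"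
proof (rule symbol_inject)
  show "left_mult s o\<^sub>L left_mult t \<in> left_conv_algebra"
    using closed_subalgebra_left_conv_algebra left_mult_in_left_conv_algebra
    unfolding closed_subalgebra_def by blast
qed (simp_all add: left_mult_in_left_conv_algebra symbol_compose)

lemma translations_eq_range_left_mult:
  "{T \<in> bounded_ops. \<exists>s. is_left_conv (delta s) T} =
   range (left_mult :: 's::finite_factorization_monoid \<Rightarrow> _)"
proof (intro equalityI subsetI)
  fix T :: "'s oper" assume "T \<in> {T \<in> bounded_ops. \<exists>s. is_left_conv (delta s) T}"
  then obtain s where "T \<in> bounded_ops" "is_left_conv (delta s) T"
    by blast
  then have "T \<in> left_conv_algebra" "symbol T = pt s"
    by (auto simp: left_conv_algebra_def is_left_conv_def symbol_def conv_eq_fconv)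
  then have "T = left_mult s"
    by (intro symbol_inject) (auto simp: left_mult_in_left_conv_algebra)
  then show "T \<in> range left_mult"
    by blast
next
  fix T :: "'s oper" assume "T \<in> range left_mult"
  then obtain s where T: "T = left_mult s"
    by blast
  have "is_left_conv (delta s) T"
    by (simp add: T is_left_conv_def conv_eq_fconv coord_left_conv left_mult_in_left_conv_algebra)
  with left_mult_in_left_conv_algebra[of s]
  show "T \<in> {T \<in> bounded_ops. \<exists>s. is_left_conv (delta s) T}"
    by (auto simp: T left_conv_algebra_def)
qed

text \<open>
  The induction principle for the generated algebra, in terms of the operators \<open>L\<^sub>s\<close>.
\<close>
lemma semigroup_banach_algebra_least:
  fixes K :: "'s::finite_factorization_monoid oper set"
  assumes "closed_subalgebra K" "range left_mult \<subseteq> K"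
  shows "semigroup_banach_algebra \<subseteq> K"
  using assms unfolding semigroup_banach_algebra_def banach_algebra_generated_def
    translations_eq_range_left_mult by blast

lemma semigroup_banach_algebra_subset:
  "(semigroup_banach_algebra :: 's::finite_factorization_monoid oper set) \<subseteq> left_conv_algebra"
  by (intro semigroup_banach_algebra_least closed_subalgebra_left_conv_algebra)
    (auto simp: left_mult_in_left_conv_algebra)

lemma left_mult_in_semigroup_banach_algebra: "left_mult s \<in> semigroup_banach_algebra"
  unfolding semigroup_banach_algebra_def banach_algebra_generated_def
    translations_eq_range_left_mult by blast

lemma closed_subalgebra_semigroup_banach_algebra:
  "closed_subalgebra (semigroup_banach_algebra :: 's::finite_factorization_monoid oper set)"
proof -
  have "semigroup_banach_algebra \<subseteq> (bounded_ops :: 's oper set)"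
    using semigroup_banach_algebra_subset by (auto simp: left_conv_algebra_def)
  moreover have "closed (semigroup_banach_algebra :: 's oper set)"
    unfolding semigroup_banach_algebra_def banach_algebra_generated_def
    by (rule closed_Inter) (auto simp: closed_subalgebra_def)
  ultimately show ?thesis
    unfolding closed_subalgebra_def[of semigroup_banach_algebra]
    by (auto simp: semigroup_banach_algebra_def banach_algebra_generated_def closed_subalgebra_def)
qed

section \<open>The cocycle of a derivation\<close>
lemma scaleC_op_of_real: "scaleC_op (complex_of_real r) T = r *\<^sub>R T"
  by (rule blinfun_eqI) (simp add: scaleC_op_apply blinfun.scaleR_left scaleR_ell2_def)

locale semigroup_derivation =
  fixes D :: "'s::finite_factorization_monoid oper \<Rightarrow> 's oper"
  assumes D: "D \<in> continuous_derivations semigroup_banach_algebra left_conv_algebra"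
begin

lemma derivation_outside: "T \<notin> semigroup_banach_algebra \<Longrightarrow> D T = 0"
  and derivation_in_left_conv_algebra: "T \<in> semigroup_banach_algebra \<Longrightarrow> D T \<in> left_conv_algebra"
  and derivation_add: "\<lbrakk>T \<in> semigroup_banach_algebra; U \<in> semigroup_banach_algebra\<rbrakk> \<Longrightarrow>
    D (T + U) = D T + D U"
  and derivation_scaleC: "T \<in> semigroup_banach_algebra \<Longrightarrow> D (scaleC_op c T) = scaleC_op c (D T)"
  and derivation_compose: "\<lbrakk>T \<in> semigroup_banach_algebra; U \<in> semigroup_banach_algebra\<rbrakk> \<Longrightarrow>
    D (T o\<^sub>L U) = (T o\<^sub>L D U) + (D T o\<^sub>L U)"
  and derivation_continuous: "continuous_on semigroup_banach_algebra D"
  using D unfolding continuous_derivations_def by blast+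

lemma derivation_zero: "D 0 = 0"
proof -
  have "0 \<in> (semigroup_banach_algebra :: 's oper set)"
    using closed_subalgebra_semigroup_banach_algebra by (auto simp: closed_subalgebra_def)
  then show ?thesis
    using derivation_add[of 0 0] by simp
qed

text \<open>
  A continuous linear map is bounded, and the operators \<open>L\<^sub>s\<close> all have norm at most one.
\<close>
lemma derivation_bounded_on_translations:
  obtains C where "0 \<le> C" "\<And>s. norm (D (left_mult s)) \<le> C"
proof -
  have "0 \<in> (semigroup_banach_algebra :: 's oper set)"
    using closed_subalgebra_semigroup_banach_algebra by (auto simp: closed_subalgebra_def)
  then obtain d where "0 < d"
    and d: "\<And>T. \<lbrakk>T \<in> semigroup_banach_algebra; norm T < d\<rbrakk> \<Longrightarrow> norm (D T) < 1"
    using derivation_continuous unfolding continuous_on_iff dist_norm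
    by (metis derivation_zero diff_zero zero_less_one)
  have "norm (D (left_mult s)) \<le> 2 / d" for s
  proof -
    define T where "T = (d / 2) *\<^sub>R left_mult s"
    have T: "T = scaleC_op (complex_of_real (d / 2)) (left_mult s)"
      by (simp only: T_def scaleC_op_of_real)
    have "T \<in> semigroup_banach_algebra"
      using closed_subalgebra_semigroup_banach_algebra left_mult_in_semigroup_banach_algebra
      unfolding T closed_subalgebra_def by blast
    moreover have "d / 2 * norm (left_mult s) \<le> d / 2 * 1"
      using \<open>0 < d\<close> norm_left_mult_le[of s] by (intro mult_left_mono) auto
    then have "norm T < d"
      using \<open>0 < d\<close> by (simp add: T_def)
    ultimately have "norm (D T) < 1"
      by (rule d)
    moreover have "D T = (d / 2) *\<^sub>R D (left_mult s)"
      using derivation_scaleC[OF left_mult_in_semigroup_banach_algebra] unfolding T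
      by (metis scaleC_op_of_real)
    ultimately show ?thesis
      using \<open>0 < d\<close> by (simp add: field_simps)
  qed
  with \<open>0 < d\<close> that[of "2 / d"] show ?thesis
    by simp
qed

text \<open>
  The function \<open>f\<^sub>s\<close> with \<open>D(L\<^sub>s) h = f\<^sub>s * h\<close> for all \<open>h\<close>.
\<close>
definition cocycle :: "'s \<Rightarrow> 's \<Rightarrow> complex" where
  "cocycle s = symbol (D (left_mult s))"

lemma derivation_left_mult: "D (left_mult s) \<in> left_conv_algebra"
  by (simp add: derivation_in_left_conv_algebra left_mult_in_semigroup_banach_algebra)

lemma cocycle_mult: "cocycle (s * t) x = (pt s \<star> cocycle t) x + (cocycle s \<star> pt t) x"
  by (simp add: cocycle_def left_mult_mult derivation_compose left_mult_in_semigroup_banach_algebra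
      symbol_add symbol_compose left_mult_in_left_conv_algebra derivation_left_mult)

text \<open>
  By cancellation \<open>s \<mapsto> f\<^sub>s(s)\<close> is a homomorphism into the additive group of the complex numbers. It is bounded
  because \<open>D\<close> is bounded on the operators \<open>L\<^sub>s\<close>, hence it vanishes.
\<close>
lemma cocycle_diagonal: "cocycle s s = 0"
proof -
  have mult: "cocycle (u * v) (u * v) = cocycle u u + cocycle v v" for u v
    by (simp add: cocycle_mult)
  have power: "cocycle (s ^ n) (s ^ n) = of_nat n * cocycle s s" for n
    using mult[of 1 1] by (induction n) (auto simp: mult algebra_simps)
  obtain C where C: "\<And>t. norm (D (left_mult t)) \<le> C"
    by (rule derivation_bounded_on_translations) blast
  have "real n * cmod (cocycle s s) \<le> C" for n
  proof -
    have "real n * cmod (cocycle s s) = cmod (cocycle (s ^ n) (s ^ n))"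
      by (simp add: power norm_mult)
    also have "\<dots> \<le> C"
      unfolding cocycle_def using cmod_symbol_le_norm C by (rule order_trans)
    finally show ?thesis .
  qed
  then show ?thesis
    by (metis norm_le_zero_iff not_le reals_Archimedean3)
qed

text \<open>
  The operators on which two continuous derivations agree form a closed subalgebra, so a commutator that
  reproduces \<open>D\<close> on generators reproduces it everywhere.
\<close>
lemma closed_subalgebra_commutator:
  assumes "M \<in> left_conv_algebra"
  shows "closed_subalgebra {T \<in> semigroup_banach_algebra. D T = (T o\<^sub>L M) - (M o\<^sub>L T)}"
proof -
  note sub = closed_subalgebra_semigroup_banach_algebra[where 's = 's, unfolded closed_subalgebra_def]
  have M: "blinfun_apply M (scaleC_ell2 c f) = scaleC_ell2 c (blinfun_apply M f)" for c f
    using assms by (auto simp: left_conv_algebra_iff bounded_opsD)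
  show ?thesis
    unfolding closed_subalgebra_def
  proof (intro conjI ballI allI)
    have "continuous_on semigroup_banach_algebra (\<lambda>T. D T - ((T o\<^sub>L M) - (M o\<^sub>L T)))"
      by (intro continuous_intros derivation_continuous
          bounded_bilinear.continuous_on[OF bounded_bilinear_blinfun_compose])
    then have "closed {T \<in> semigroup_banach_algebra. D T - ((T o\<^sub>L M) - (M o\<^sub>L T)) = 0}"
      using sub by (intro continuous_closed_preimage_constant) auto
    then show "closed {T \<in> semigroup_banach_algebra. D T = (T o\<^sub>L M) - (M o\<^sub>L T)}"
      by simp
  next
    fix T U c
    assume T: "T \<in> {T \<in> semigroup_banach_algebra. D T = (T o\<^sub>L M) - (M o\<^sub>L T)}"
      and U: "U \<in> {T \<in> semigroup_banach_algebra. D T = (T o\<^sub>L M) - (M o\<^sub>L T)}"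
    show "T + U \<in> {T \<in> semigroup_banach_algebra. D T = (T o\<^sub>L M) - (M o\<^sub>L T)}"
      using T U sub
      by (auto simp: derivation_add intro!: blinfun_eqI)
        (simp add: blinfun.bilinear_simps)
    show "T o\<^sub>L U \<in> {T \<in> semigroup_banach_algebra. D T = (T o\<^sub>L M) - (M o\<^sub>L T)}"
      using T U sub
      by (auto simp: derivation_compose intro!: blinfun_eqI)
        (simp add: blinfun.bilinear_simps)
    show "scaleC_op c T \<in> {T \<in> semigroup_banach_algebra. D T = (T o\<^sub>L M) - (M o\<^sub>L T)}"
      using T sub
      by (auto simp: derivation_scaleC intro!: blinfun_eqI)
        (simp add: blinfun.bilinear_simps scaleC_op_apply M
          bounded_linear_scaleC_ell2[THEN bounded_linear.linear, THEN linear_diff])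
  qed (use sub in \<open>auto simp: derivation_zero intro!: blinfun_eqI\<close>)
qed

text \<open>
  Since \<open>L\<^sub>e\<close> acts as a unit, \<open>D(L\<^sub>e L\<^sub>e)\<close> is twice \<open>D(L\<^sub>e)\<close>.
\<close>
lemma derivation_left_mult_one: "D (left_mult 1) = 0"
proof (rule symbol_inject)
  show "D (left_mult 1) \<in> left_conv_algebra"
    by (rule derivation_left_mult)
  show "(0 :: 's oper) \<in> left_conv_algebra"
    using closed_subalgebra_left_conv_algebra by (auto simp: closed_subalgebra_def)
  have "cocycle 1 x = 0" for x
    using cocycle_mult[of 1 1 x] by simp
  then show "symbol (D (left_mult 1)) = symbol 0"
    by (simp add: cocycle_def[symmetric] symbol_def[of 0] zero_ell2.rep_eq fun_eq_iff)
qed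

end

section \<open>Derivations for Thompson's monoid\<close>
locale thompson_derivation = semigroup_derivation D
  for D :: "thompson oper \<Rightarrow> thompson oper"
begin

text \<open>
  The relation \<open>X\<^sub>n X\<^sub>i = X\<^sub>i X\<^bsub>n+1\<^esub>\<close> as seen by the derivation. The arguments below evaluate it
  at points \<open>x\<close> where most of the four terms vanish for lack of a factorization of \<open>x\<close>.
\<close>
lemma cocycle_relation:
  assumes "i < n"
  shows "(pt (gen n) \<star> cocycle (gen i)) x + (cocycle (gen n) \<star> pt (gen i)) x =
    (pt (gen i) \<star> cocycle (gen (Suc n))) x + (cocycle (gen i) \<star> pt (gen (Suc n))) x"
  using gen_relation[OF assms] by (metis cocycle_mult)

text \<open>
  The part of \<open>D\<close> that preserves the degree has to be shown to vanish separately, because it cannot be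
  seen in the limit that defines the implementing operator: a commutator with an element of degree zero,
  a multiple of the unit, is zero. The diagonal entries vanish by boundedness. The others vanish since the
  words \<open>X\<^sub>j X\<^sub>j\<close> and \<open>X\<^sub>j X\<^bsub>j+1\<^esub>\<close> have very few factorizations.
\<close>
lemma cocycle_gen_gen: "cocycle (gen i) (gen j) = 0"
proof -
  have right: "(a \<star> pt (gen i)) (gen j * gen k) = 0"
    if "\<And>l. gen j * gen k \<noteq> gen l * gen i" for a i j k
  proof (rule fconv_pt_right_eq_0)
    fix y show "gen j * gen k \<noteq> y * gen i"
      using that word_length_eq_1D[of y] by (metis add_right_cancel word_length_gen word_length_mult)
  qed
  have left: "(pt (gen i) \<star> a) (gen j * gen k) = 0"
    if "\<And>l. gen j * gen k \<noteq> gen i * gen l" for a i j k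
  proof (rule fconv_pt_left_eq_0)
    fix y show "gen j * gen k \<noteq> gen i * y"
      using that word_length_eq_1D[of y] by (metis add_left_cancel word_length_gen word_length_mult)
  qed
  have far: "cocycle (gen k) (gen j) = 0" if "Suc j < k" for j k
    using cocycle_relation[of "Suc j" k "gen j * gen (Suc j)"] that
    by (simp add: left right gen_mult_gen_eq_iff)
  consider "i < j" | "i = j" | "i = Suc j" | "Suc j < i"
    by linarith
  then show ?thesis
  proof cases
    case 1
    then show ?thesis
      using cocycle_relation[of i j "gen j * gen j"]
      by (simp add: left right gen_mult_gen_eq_iff)
  next
    case 2
    then show ?thesis
      by (simp add: cocycle_diagonal)
  next
    case 3
    then show ?thesis
      using cocycle_relation[of j i "gen j * gen j"] far[of j "Suc i"]
      by (simp add: left right gen_mult_gen_eq_iff)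
  next
    case 4
    then show ?thesis
      by (rule far)
  qed
qed

text \<open>
  Compare \<open>f\<close> at \<open>X\<^sub>n\<close> and \<open>X\<^bsub>n+1\<^esub>\<close> with \<open>f\<close> at \<open>X\<^sub>a\<close>, where \<open>a\<close> is large for \<open>v\<close> and \<open>n\<close> is large
  for \<open>v\<close> and \<open>a\<close>. At \<open>x = X\<^sub>n X\<^sub>a v = X\<^sub>a X\<^bsub>n+1\<^esub> v\<close> both terms with a right factor vanish, because for
  \<open>v \<noteq> e\<close> pushing the large letters through \<open>v\<close> shifts their indices away from \<open>a\<close> and \<open>n + 1\<close>. What remains
  is \<open>f(X\<^sub>a)(X\<^sub>a v) = f(X\<^bsub>n+1\<^esub>)(X\<^bsub>n+1\<^esub> v)\<close>, whose left side is independent of \<open>n\<close>.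
\<close>
lemma cocycle_eventually_constant:
  "\<exists>c. \<forall>\<^sub>F n in sequentially. cocycle (gen n) (gen n * v) = c"
proof (cases "v = 1")
  case True
  then show ?thesis
    by (simp add: cocycle_diagonal)
next
  case False
  define p where "p = word_length v"
  with False have "0 < p"
    by (metis word_length_eq_0_iff neq0_conv)
  have "\<forall>\<^sub>F a in sequentially. gen a * v = v * gen (a + p) \<and> (\<forall>t. v \<noteq> t * gen a)"
    unfolding p_def by (intro eventually_conj eventually_gen_mult eventually_not_right_factor)
  then obtain a where a: "gen a * v = v * gen (a + p)" "\<And>t. v \<noteq> t * gen a"
    using eventually_happens'[OF sequentially_bot] by blast
  have "\<forall>\<^sub>F n in sequentially. cocycle (gen (Suc n)) (gen (Suc n) * v) = cocycle (gen a) (gen a * v)"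
    using eventually_shift[OF eventually_gen_mult[of v], of 1] eventually_not_right_factor[of v]
      eventually_gt_at_top[of "a + p"]
  proof eventually_elim
    case (elim n)
    have x: "gen n * (gen a * v) = gen a * (gen (Suc n) * v)"
      using gen_relation[of a n] elim(3) by (simp flip: mult.assoc)
    also have "gen (Suc n) * v = v * gen (Suc n + p)"
      using elim(1) by (simp add: p_def)
    also have "gen a * (v * gen (Suc n + p)) = v * gen (a + p) * gen (Suc n + p)"
      by (simp only: a(1) flip: mult.assoc)
    finally have x': "gen n * (gen a * v) = v * gen (a + p) * gen (Suc n + p)" .
    have "gen n * (gen a * v) \<noteq> y * gen a" for y
    proof
      assume "gen n * (gen a * v) = y * gen a"
      with x' have "v * gen (a + p) * gen (Suc n + p) = y * gen a" "a < Suc n + p"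
        using elim(3) by simp_all
      then obtain t where "v * gen (a + p) = t * gen a"
        by (rule mult_gen_eq_mult_genD)
      moreover have "a < a + p"
        using \<open>0 < p\<close> by simp
      ultimately obtain t' where "v = t' * gen a"
        by (rule mult_gen_eq_mult_genD)
      with a(2) show False
        by blast
    qed
    then have "(cocycle (gen n) \<star> pt (gen a)) (gen n * (gen a * v)) = 0"
      by (rule fconv_pt_right_eq_0)
    moreover have "gen n * (gen a * v) \<noteq> y * gen (Suc n)" for y
    proof
      assume "gen n * (gen a * v) = y * gen (Suc n)"
      with x' have "v * gen (a + p) * gen (Suc n + p) = y * gen (Suc n)" "Suc n < Suc n + p"
        using \<open>0 < p\<close> by simp_all
      then obtain t where "v * gen (a + p) = t * gen (Suc n)"
        by (rule mult_gen_eq_mult_genD)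
      then have "t * gen (Suc n) = v * gen (a + p)" "a + p < Suc n"
        using elim(3) by simp_all
      then obtain t' where "v = t' * gen (Suc n - 1)"
        by (rule mult_gen_eq_mult_genD)
      with elim(2) show False
        by auto
    qed
    then have "(cocycle (gen a) \<star> pt (gen (Suc n))) (gen n * (gen a * v)) = 0"
      by (rule fconv_pt_right_eq_0)
    moreover have "(pt (gen a) \<star> cocycle (gen (Suc n))) (gen n * (gen a * v)) =
        cocycle (gen (Suc n)) (gen (Suc n) * v)"
      unfolding x by (rule fconv_pt_left)
    ultimately show ?case
      using cocycle_relation[of a n "gen n * (gen a * v)"] elim(3) by simp
  qed
  then show ?thesis
    by (subst (asm) eventually_sequentially_Suc) blast
qed

text \<open>
  The pointwise limit of \<open>X\<^sub>n\<^sup>* f(X\<^sub>n)\<close>, where \<open>X\<^sub>n\<^sup>*\<close> is the adjoint of left multiplication by \<open>X\<^sub>n\<close>.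
\<close>
definition implementing_symbol :: "thompson \<Rightarrow> complex" where
  "implementing_symbol v =
    (SOME c. \<forall>\<^sub>F n in sequentially. cocycle (gen n) (gen n * v) = c)"

lemma eventually_implementing_symbol:
  "\<forall>\<^sub>F n in sequentially. cocycle (gen n) (gen n * v) = implementing_symbol v"
  unfolding implementing_symbol_def by (rule someI_ex[OF cocycle_eventually_constant])

text \<open>
  Evaluate the relation for \<open>X\<^sub>n\<close> and \<open>X\<^sub>i\<close> at \<open>X\<^sub>n u\<close> with \<open>n\<close> large. One term is \<open>f(X\<^sub>i)(u)\<close>, two terms
  have the values of \<open>g X\<^sub>i\<close> and \<open>X\<^sub>i g\<close> at \<open>u\<close> for the limit \<open>g\<close>, and the last one vanishes unless \<open>u\<close> has
  the degree one of \<open>X\<^sub>i\<close>, where both sides are zero.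
\<close>
lemma cocycle_gen_eq_commutator:
  "cocycle (gen i) u =
    (pt (gen i) \<star> implementing_symbol) u - (implementing_symbol \<star> pt (gen i)) u"
proof (cases "word_length u = 1")
  case True
  then obtain k where u: "u = gen k"
    by (rule word_length_eq_1D)
  show ?thesis
  proof (cases "k = i")
    case True
    then show ?thesis
      using fconv_pt_left[of "gen i" implementing_symbol 1]
        fconv_pt_right[of implementing_symbol "gen i" 1]
      by (simp add: u True cocycle_gen_gen)
  next
    case False
    have *: "gen k = gen i" if eq: "gen k = gen i * y \<or> gen k = y * gen i" for y
    proof -
      have "word_length y = 0"
        using eq by (elim disjE) (drule arg_cong[where f = word_length], simp)+
      with eq show ?thesis
        by simp
    qed
    have "gen k \<noteq> gen i"
      using False by (simp flip: left_nf_eq_iff)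
    with * have "u \<noteq> gen i * y" "u \<noteq> y * gen i" for y
      unfolding u by blast+
    then have "(pt (gen i) \<star> implementing_symbol) u = 0" "(implementing_symbol \<star> pt (gen i)) u = 0"
      by (simp_all only: fconv_pt_left_eq_0 fconv_pt_right_eq_0 not_False_eq_True)
    then show ?thesis
      by (simp add: u cocycle_gen_gen)
  qed
next
  case False
  have right: "\<forall>\<^sub>F n in sequentially. (cocycle (gen n) \<star> pt (gen i)) (gen n * u) =
      (implementing_symbol \<star> pt (gen i)) u"
  proof (cases "\<exists>u'. u = u' * gen i")
    case True
    then obtain u' where u: "u = u' * gen i" ..
    from eventually_implementing_symbol[of u'] show ?thesis
      by eventually_elim (simp add: u flip: mult.assoc)
  next
    case False
    then have "(implementing_symbol \<star> pt (gen i)) u = 0"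
      by (intro fconv_pt_right_eq_0) blast
    moreover from eventually_gen_mult_factor[of u "gen i"]
    have "\<forall>\<^sub>F n in sequentially. (cocycle (gen n) \<star> pt (gen i)) (gen n * u) = 0"
    proof eventually_elim
      case (elim n)
      with False have "gen n * u \<noteq> y * gen i" for y
        by blast
      then show ?case
        by (rule fconv_pt_right_eq_0)
    qed
    ultimately show ?thesis
      by simp
  qed
  have left: "\<forall>\<^sub>F n in sequentially. (pt (gen i) \<star> cocycle (gen (Suc n))) (gen n * u) =
      (pt (gen i) \<star> implementing_symbol) u"
  proof (cases "\<exists>u'. u = gen i * u'")
    case True
    then obtain u' where u: "u = gen i * u'" ..
    show ?thesis
      using eventually_shift[OF eventually_implementing_symbol[of u'], of 1]
        eventually_gt_at_top[of i]
    proof eventually_elim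
      case (elim n)
      have "gen n * u = gen i * (gen (Suc n) * u')"
        using gen_relation[OF elim(2)] by (simp add: u flip: mult.assoc)
      with elim show ?case
        by (simp add: u)
    qed
  next
    case False
    then have 0: "(pt (gen i) \<star> implementing_symbol) u = 0"
      by (intro fconv_pt_left_eq_0) blast
    from eventually_gt_at_top[of i] show ?thesis
    proof eventually_elim
      case (elim n)
      have "gen n * u \<noteq> gen i * w" for w
      proof
        assume "gen n * u = gen i * w"
        then obtain u' where "u = gen i * u'"
          using elim by (rule gen_mult_eq_gen_multD)
        with False show False
          by blast
      qed
      then have "(pt (gen i) \<star> cocycle (gen (Suc n))) (gen n * u) = 0"
        by (rule fconv_pt_left_eq_0)
      with 0 show ?case
        by simp
    qed
  qed
  have "\<forall>\<^sub>F n in sequentially. cocycle (gen i) u =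
      (pt (gen i) \<star> implementing_symbol) u - (implementing_symbol \<star> pt (gen i)) u"
    using left right eventually_gen_mult_not_right_factor[OF False] eventually_gt_at_top[of i]
  proof eventually_elim
    case (elim n)
    then have "(cocycle (gen i) \<star> pt (gen (Suc n))) (gen n * u) = 0"
      by (intro fconv_pt_right_eq_0) auto
    with cocycle_relation[of i n "gen n * u"] elim show ?case
      by (simp add: algebra_simps)
  qed
  then show ?thesis
    by simp
qed

text \<open>
  The convolution by the limit, on the part of \<open>a\<close> that matters for the value at \<open>x\<close>, is read off from the
  bounded operator \<open>D(L(X\<^sub>n))\<close> for one sufficiently large \<open>n\<close>.
\<close>
lemma fconv_implementing_symbol_eq:
  fixes a :: "thompson \<Rightarrow> complex"
  assumes u: "\<And>u v. u * v = x \<Longrightarrow> cocycle (gen n) (gen n * u) = implementing_symbol u"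
    and v: "\<And>u v. u * v = x \<Longrightarrow> v \<in> W"
    and factor: "\<And>v w. \<lbrakk>w \<in> W; gen n * x = v * w\<rbrakk> \<Longrightarrow> \<exists>v'. v = gen n * v' \<and> x = v' * w"
  shows "(cocycle (gen n) \<star> (\<lambda>w. if w \<in> W then a w else 0)) (gen n * x) =
    (implementing_symbol \<star> a) x"
proof -
  let ?a = "\<lambda>w. if w \<in> W then a w else 0"
  let ?F = "\<lambda>x :: thompson. {(u, v). u * v = x}"
  have inj: "inj_on (\<lambda>(u, v). (gen n * u, v)) (?F x)"
    by (rule inj_onI) (simp add: case_prod_beta thompson_left_cancel prod_eq_iff)
  have "(cocycle (gen n) \<star> ?a) (gen n * x) =
      (\<Sum>(u, v)\<in>(\<lambda>(u, v). (gen n * u, v)) ` ?F x. cocycle (gen n) u * ?a v)"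
    unfolding fconv_def
  proof (rule sum.mono_neutral_right)
    show "\<forall>p\<in>?F (gen n * x) - (\<lambda>(u, v). (gen n * u, v)) ` ?F x.
        (case p of (u, v) \<Rightarrow> cocycle (gen n) u * ?a v) = 0"
    proof clarify
      fix u v
      assume uv: "u * v = gen n * x" and not_image: "(u, v) \<notin> (\<lambda>(u, v). (gen n * u, v)) ` ?F x"
      have "v \<notin> W"
      proof
        assume "v \<in> W"
        from factor[OF this uv[symmetric]] obtain u' where "u = gen n * u'" "x = u' * v"
          by blast
        then have "(u, v) \<in> (\<lambda>(u, v). (gen n * u, v)) ` ?F x"
          by (intro image_eqI[of _ _ "(u', v)"]) simp_all
        with not_image show False ..
      qed
      then show "cocycle (gen n) u * ?a v = 0"
        by simp
    qed
    show "(\<lambda>(u, v). (gen n * u, v)) ` ?F x \<subseteq> ?F (gen n * x)"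
      by (auto simp: mult.assoc)
  qed (rule finite_factorizations)
  also have "\<dots> = (\<Sum>(u, v)\<in>?F x. cocycle (gen n) (gen n * u) * ?a v)"
    by (subst sum.reindex[OF inj]) (simp add: comp_def case_prod_beta)
  also have "\<dots> = (\<Sum>(u, v)\<in>?F x. implementing_symbol u * a v)"
  proof (rule sum.cong)
    fix p assume "p \<in> ?F x"
    then have "fst p * snd p = x"
      by (simp add: case_prod_beta)
    from u[OF this] v[OF this]
    show "(case p of (u, v) \<Rightarrow> cocycle (gen n) (gen n * u) * ?a v) =
        (case p of (u, v) \<Rightarrow> implementing_symbol u * a v)"
      by (simp add: case_prod_beta)
  qed simp
  finally show ?thesis
    by (simp add: fconv_def)
qed

text \<open>
  Finitely many values of the convolution only involve the restriction of \<open>h\<close> to a finite set, and for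
  some large \<open>n\<close> all of them are coordinates of the image of this restriction under \<open>D(L(X\<^sub>n))\<close>. So the
  bound for \<open>D\<close> on translations passes to the limit.
\<close>
lemma implementing_symbol_bounded:
  assumes C: "\<And>s. norm (D (left_mult s)) \<le> C" and E: "finite E"
  shows "(\<Sum>x\<in>E. (cmod ((implementing_symbol \<star> coord h) x))\<^sup>2) \<le> (C * norm h)\<^sup>2"
proof -
  \<comment> \<open>The right factors of the elements of \<open>E\<close>: the convolution sees \<open>h\<close> on \<open>E\<close> only through these.\<close>
  define W where "W = (\<Union>x\<in>E. snd ` {(u, v). u * v = x})"
  have "finite W"
    by (simp add: W_def E finite_factorizations)
  have W: "v \<in> W" if "u * v = x" "x \<in> E" for u v x
    unfolding W_def using that by (auto intro!: bexI[of _ x] image_eqI[of _ _ "(u, v)"])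
  obtain hW :: "thompson ell2"
    where hW: "coord hW = (\<lambda>w. if w \<in> W then coord h w else 0)" and "norm hW \<le> norm h"
  proof (rule ell2_of_bounded_sums[of "norm h" "\<lambda>w. if w \<in> W then coord h w else 0"])
    fix E' :: "thompson set" assume "finite E'"
    have "(\<Sum>w\<in>E'. (cmod (if w \<in> W then coord h w else 0))\<^sup>2) \<le> (\<Sum>w\<in>E'. (cmod (coord h w))\<^sup>2)"
      by (rule sum_mono) auto
    also have "\<dots> \<le> (norm h)\<^sup>2"
      by (rule sum_coord_le_norm) fact
    finally show "(\<Sum>w\<in>E'. (cmod (if w \<in> W then coord h w else 0))\<^sup>2) \<le> (norm h)\<^sup>2" .
  qed simp_all
  have "\<forall>\<^sub>F n in sequentially.
      (\<forall>x\<in>E. \<forall>w\<in>W. \<forall>v. gen n * x = v * w \<longrightarrow> (\<exists>v'. v = gen n * v' \<and> x = v' * w)) \<and>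
      (\<forall>x\<in>E. \<forall>p\<in>{(u, v). u * v = x}. cocycle (gen n) (gen n * fst p) = implementing_symbol (fst p))"
    using E \<open>finite W\<close> finite_factorizations
    by (intro eventually_conj eventually_ball_finite ballI eventually_gen_mult_factor
        eventually_implementing_symbol)
  then obtain n where
    factor: "\<forall>x\<in>E. \<forall>w\<in>W. \<forall>v. gen n * x = v * w \<longrightarrow> (\<exists>v'. v = gen n * v' \<and> x = v' * w)" and
    limit: "\<forall>x\<in>E. \<forall>p\<in>{(u, v). u * v = x}.
      cocycle (gen n) (gen n * fst p) = implementing_symbol (fst p)"
    using eventually_happens'[OF sequentially_bot] by blast
  have "(implementing_symbol \<star> coord h) x = coord (blinfun_apply (D (left_mult (gen n))) hW) (gen n * x)"
    if "x \<in> E" for x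
    unfolding coord_left_conv[OF derivation_left_mult] cocycle_def[symmetric] hW
  proof (rule fconv_implementing_symbol_eq[symmetric])
    show "cocycle (gen n) (gen n * u) = implementing_symbol u" if "u * v = x" for u v
      using bspec[OF bspec[OF limit \<open>x \<in> E\<close>], of "(u, v)"] that by simp
    show "v \<in> W" if "u * v = x" for u v
      using W that \<open>x \<in> E\<close> by blast
    show "\<exists>v'. v = gen n * v' \<and> x = v' * w" if "w \<in> W" "gen n * x = v * w" for v w
      using factor \<open>x \<in> E\<close> that by blast
  qed
  then have "(\<Sum>x\<in>E. (cmod ((implementing_symbol \<star> coord h) x))\<^sup>2) =
      (\<Sum>y\<in>(*) (gen n) ` E. (cmod (coord (blinfun_apply (D (left_mult (gen n))) hW) y))\<^sup>2)"
    by (subst sum.reindex) (auto intro!: inj_onI sum.cong simp: thompson_left_cancel)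
  also have "\<dots> \<le> (norm (blinfun_apply (D (left_mult (gen n))) hW))\<^sup>2"
    by (rule sum_coord_le_norm) (simp add: E)
  also have "\<dots> \<le> (C * norm h)\<^sup>2"
  proof (rule power_mono)
    have "norm (blinfun_apply (D (left_mult (gen n))) hW) \<le> norm (D (left_mult (gen n))) * norm hW"
      by (rule norm_blinfun)
    also have "\<dots> \<le> C * norm h"
      using C[of "gen n"] \<open>norm hW \<le> norm h\<close> order_trans[OF norm_ge_zero C[of "gen n"]]
      by (intro mult_mono) simp_all
    finally show "norm (blinfun_apply (D (left_mult (gen n))) hW) \<le> C * norm h" .
  qed simp
  finally show ?thesis .
qed

lemma derivation_inner: "D \<in> inner_derivations semigroup_banach_algebra left_conv_algebra"
proof -
  obtain C where C: "0 \<le> C" "\<And>s. norm (D (left_mult s)) \<le> C"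
    using derivation_bounded_on_translations by blast
  obtain M where M: "M \<in> left_conv_algebra" and symbol: "symbol M = implementing_symbol"
    by (rule left_conv_of_bounded_sums[OF C(1) implementing_symbol_bounded[OF C(2)]])
  define K where "K = {T \<in> semigroup_banach_algebra. D T = (T o\<^sub>L M) - (M o\<^sub>L T)}"
  have K: "closed_subalgebra K"
    unfolding K_def by (rule closed_subalgebra_commutator[OF M])
  note sub = closed_subalgebra_left_conv_algebra[where 's = thompson]
  have comm: "(left_mult s o\<^sub>L M) - (M o\<^sub>L left_mult s) \<in> left_conv_algebra" for s
    using closed_subalgebra_diff[OF sub] sub M left_mult_in_left_conv_algebra[of s]
    unfolding closed_subalgebra_def by blast
  have gen: "left_mult (gen i) \<in> K" for i
  proof -
    have "D (left_mult (gen i)) = (left_mult (gen i) o\<^sub>L M) - (M o\<^sub>L left_mult (gen i))"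
      using derivation_left_mult comm
    proof (rule symbol_inject)
      show "symbol (D (left_mult (gen i))) = symbol ((left_mult (gen i) o\<^sub>L M) - (M o\<^sub>L left_mult (gen i)))"
        unfolding cocycle_def[symmetric]
        by (simp add: fun_eq_iff cocycle_gen_eq_commutator symbol_diff symbol_compose
            left_mult_in_left_conv_algebra M symbol)
    qed
    then show ?thesis
      by (simp add: K_def left_mult_in_semigroup_banach_algebra)
  qed
  have "left_mult s \<in> K" for s
  proof (induction s rule: thompson_left_induct)
    case one
    have "(left_mult 1 o\<^sub>L M) - (M o\<^sub>L left_mult 1) = 0"
    proof (rule symbol_inject[OF comm])
      show "(0 :: thompson oper) \<in> left_conv_algebra"
        using sub by (auto simp: closed_subalgebra_def)
    qed (simp add: symbol_diff symbol_compose left_mult_in_left_conv_algebra M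
        symbol_def[of 0] zero_ell2.rep_eq)
    then show ?case
      by (simp add: K_def left_mult_in_semigroup_banach_algebra derivation_left_mult_one)
  next
    case (gen_mult i s)
    with gen[of i] K show ?case
      unfolding left_mult_mult closed_subalgebra_def by blast
  qed
  then have "semigroup_banach_algebra \<subseteq> K"
    using K by (intro semigroup_banach_algebra_least) auto
  then have "D = inner_derivation semigroup_banach_algebra M"
    by (auto simp: inner_derivation_def K_def fun_eq_iff derivation_outside)
  with M show ?thesis
    by (auto simp: inner_derivations_def)
qed

end

section \<open>First cohomology\<close>
lemma inner_derivation_continuous_derivation:
  assumes A: "closed_subalgebra A" and X: "closed_subalgebra X" and "A \<subseteq> X" and M: "M \<in> X"
  shows "inner_derivation A M \<in> continuous_derivations A X"
  unfolding continuous_derivations_def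
proof (intro CollectI conjI ballI allI impI)
  fix T U c assume T: "T \<in> A" and U: "U \<in> A"
  have AD: "T + U \<in> A" "scaleC_op c T \<in> A" "T o\<^sub>L U \<in> A"
    using A T U unfolding closed_subalgebra_def by blast+
  have "M \<in> bounded_ops"
    using X M by (auto simp: closed_subalgebra_def)
  note M' = bounded_opsD[OF this]
  show "inner_derivation A M T \<in> X"
    using T M X \<open>A \<subseteq> X\<close> closed_subalgebra_diff[OF X]
    unfolding inner_derivation_def closed_subalgebra_def by auto
  show "inner_derivation A M (T + U) = inner_derivation A M T + inner_derivation A M U"
    unfolding inner_derivation_def using T U AD
    by (auto intro!: blinfun_eqI simp: blinfun.bilinear_simps)
  show "inner_derivation A M (scaleC_op c T) = scaleC_op c (inner_derivation A M T)"
    unfolding inner_derivation_def using T AD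
    by (auto intro!: blinfun_eqI simp: blinfun.bilinear_simps scaleC_op_apply M'
        bounded_linear_scaleC_ell2[THEN bounded_linear.linear, THEN linear_diff])
  show "inner_derivation A M (T o\<^sub>L U) =
      (T o\<^sub>L inner_derivation A M U) + (inner_derivation A M T o\<^sub>L U)"
    unfolding inner_derivation_def using T U AD
    by (auto intro!: blinfun_eqI simp: blinfun.bilinear_simps)
next
  have "continuous_on A (\<lambda>T. (T o\<^sub>L M) - (M o\<^sub>L T))"
    by (intro continuous_intros bounded_bilinear.continuous_on[OF bounded_bilinear_blinfun_compose])
  then show "continuous_on A (inner_derivation A M)"
    by (rule continuous_on_cong[THEN iffD1, rotated -1]) (auto simp: inner_derivation_def)
qed (simp add: inner_derivation_def)

text \<open>
  The classes of the quotient are cosets of the inner derivations inside the continuous ones, so the inner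
  derivations must themselves be continuous derivations into \<open>X\<close>; this is where \<open>A \<subseteq> X\<close> is needed.
\<close>
lemma H1_trivial:
  assumes A: "closed_subalgebra A" and X: "closed_subalgebra X" and "A \<subseteq> X"
    and inner: "continuous_derivations A X \<subseteq> inner_derivations A X"
  shows "H1 A X = {inner_derivations A X}"
proof -
  have eq: "continuous_derivations A X = inner_derivations A X"
    using inner inner_derivation_continuous_derivation[OF A X \<open>A \<subseteq> X\<close>]
    by (auto simp: inner_derivations_def)
  have diff: "(\<lambda>T. D T - E T) \<in> inner_derivations A X"
    if DE: "D \<in> inner_derivations A X" "E \<in> inner_derivations A X" for D E
  proof -
    obtain M N where "M \<in> X" "N \<in> X" "D = inner_derivation A M" "E = inner_derivation A N"
      using DE by (auto simp: inner_derivations_def)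
    then have "(\<lambda>T. D T - E T) = inner_derivation A (M - N)"
      by (auto simp: inner_derivation_def fun_eq_iff blinfun.bilinear_simps intro!: blinfun_eqI)
    moreover have "M - N \<in> X"
      by (rule closed_subalgebra_diff) fact+
    ultimately show ?thesis
      by (auto simp: inner_derivations_def)
  qed
  have "inner_derivations A X \<noteq> {}"
    using X by (auto simp: inner_derivations_def closed_subalgebra_def)
  then show ?thesis
    unfolding H1_def eq by (auto simp: quotient_def diff)
qed

theorem theorem5p8:
  "H1 (semigroup_banach_algebra :: thompson oper set) left_conv_algebra
     = {inner_derivations semigroup_banach_algebra left_conv_algebra}"
proof (rule H1_trivial)
  show "continuous_derivations (semigroup_banach_algebra :: thompson oper set) left_conv_algebra
      \<subseteq> inner_derivations semigroup_banach_algebra left_conv_algebra"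
    by (auto intro: thompson_derivation.derivation_inner
        simp: thompson_derivation_def semigroup_derivation_def)
qed (simp_all add: closed_subalgebra_semigroup_banach_algebra closed_subalgebra_left_conv_algebra
    semigroup_banach_algebra_subset)

end
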